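(* There is a family of homeomorphisms $h_{c,c'}:S_c\to S_{c'}$, defined for all $c\ge 1$ and $c'\ge 1$, such that: (i) $h_{c,c}$ is the identity map and $h_{c',c''}\circ h_{c,c'}=h_{c,c''}$ for all $c,c',c''\ge 1$; (ii) $h_{c,c'}$ sends singular points to singular points; (iii) $h_{c,c'}(Q_c^+)=Q_{c'}^+$ and $h_{c,c'}(Q_c^-)=Q_{c'}^-$; (iv) let $B$ be the bundle over the ray $\{c: c\ge 1\}$ whose fiber over $c$ is $S_c\smallsetminus\Sigma$, the surface $S_c$ with its set $\Sigma$ of singularities removed, metrized to be locally isometric to $\mathbb{R}^3$. Then the map $B\times\{c':c'\ge 1\}\to B$ sending the pair consisting of a point $x\in S_c\smallsetminus\Sigma$ and $c'\ge 1$ to the point $h_{c,c'}(x)\in S_{c'}$ is continuous in the metric topology.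
   Context: For $c\ge 1$ let $T_c:\mathbb{R}^2\to\mathbb{R}^2$, $T_c(x,y)=(cx+(c-1)y+1,\ (c+1)x+cy+1)$, and $P_c^k=T_c^k(0,0)$ for $k\in\mathbb{Z}$. Let $Q_c^+$ be the convex hull of $\{P_c^k\}_{k\in\mathbb{Z}}$ (an infinite-sided polygon with edges $\overline{P_c^kP_c^{k+1}}$), and let $Q_c^-=-Q_c^+$ be its image under rotation by $\pi$ about the origin. The translation surface $S_c$ is obtained from $Q_c^+$ and $Q_c^-$ by gluing each edge of $Q_c^+$ by a translation (rather than a rotation) to its (parallel) image edge in $Q_c^-$. The points of $S_c$ arising from the vertices are called singularities (singular points); the set of them is denoted $\Sigma$. Away from the singularities, $S_c$ has local coordinate charts to $\mathbb{R}^2$, well defined up to translation. *)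

theory Defs
  imports "HOL-Analysis.Analysis"
begin

type_synonym plane = "real \<times> real"

definition T_map :: "real \<Rightarrow> plane \<Rightarrow> plane" where
  "T_map c = (\<lambda>(x, y). (c * x + (c - 1) * y + 1, (c + 1) * x + c * y + 1))"

lemma bij_T_map: "bij (T_map c)"
proof (rule o_bij)
  let ?S = "\<lambda>(x, y). (c * (x - 1) - (c - 1) * (y - 1), c * (y - 1) - (c + 1) * (x - 1))"
  show "?S \<circ> T_map c = id" "T_map c \<circ> ?S = id"
    by (auto simp: T_map_def fun_eq_iff algebra_simps)
qed

definition P_orb :: "real \<Rightarrow> int \<Rightarrow> plane" where
  "P_orb c k = (if 0 \<le> k then (T_map c ^^ nat k) (0, 0) else (inv (T_map c) ^^ nat (- k)) (0, 0))"

datatype half = Plus | Minus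

definition Q_plus :: "real \<Rightarrow> plane set" where
  "Q_plus c = convex hull (range (P_orb c))"

definition Q_minus :: "real \<Rightarrow> plane set" where
  "Q_minus c = uminus ` Q_plus c"

fun polygon :: "real \<Rightarrow> half \<Rightarrow> plane set" where
  "polygon c Plus = Q_plus c"
| "polygon c Minus = Q_minus c"

definition edge :: "real \<Rightarrow> int \<Rightarrow> plane set" where
  "edge c k = closed_segment (P_orb c k) (P_orb c (k + 1))"

definition pieces :: "real \<Rightarrow> (half \<times> plane) topology" where
  "pieces c = sum_topology (\<lambda>s. top_of_set (polygon c s)) UNIV"

text \<open>
  The translation by \<open>- P_orb c k - P_orb c (k + 1)\<close> takes \<open>P_orb c k\<close> to \<open>- P_orb c (k + 1)\<close> and \<open>P_orb c (k + 1)\<close> to \<open>- P_orb c k\<close>,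
  so it is the only translation taking \<open>edge c k\<close> onto \<open>uminus ` edge c k\<close>
  (\<open>edge_translation\<close> below).
\<close>
inductive glue :: "real \<Rightarrow> half \<times> plane \<Rightarrow> half \<times> plane \<Rightarrow> bool" for c where
  "p \<in> edge c k \<Longrightarrow> glue c (Plus, p) (Minus, p + (- P_orb c k - P_orb c (k + 1)))"

lemma edge_translation: "(\<lambda>p. p + (- P_orb c k - P_orb c (k + 1))) ` edge c k = uminus ` edge c k"
proof -
  have "(\<lambda>p. p + (- P_orb c k - P_orb c (k + 1))) ` edge c k
      = closed_segment (- P_orb c (k + 1)) (- P_orb c k)"
    using closed_segment_translation[of "- P_orb c k - P_orb c (k + 1)" "P_orb c k" "P_orb c (k + 1)"]
    by (simp add: edge_def add.commute algebra_simps)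
  also have "\<dots> = uminus ` edge c k"
    unfolding edge_def closed_segment_commute[of "- P_orb c (k + 1)"]
    using closed_segment_linear_image[of uminus "P_orb c k" "P_orb c (k + 1)"]
    by (simp add: linear_uminus)
  finally show ?thesis .
qed

text \<open>Points of the surface are the equivalence classes of the gluing.\<close>
type_synonym spoint = "(half \<times> plane) set"

definition cls :: "real \<Rightarrow> half \<times> plane \<Rightarrow> spoint" where
  "cls c x = {y. equivclp (glue c) x y}"

definition S_pts :: "real \<Rightarrow> spoint set" where
  "S_pts c = cls c ` topspace (pieces c)"

definition quotient_topology :: "'a topology \<Rightarrow> ('a \<Rightarrow> 'b) \<Rightarrow> 'b topology" where
  "quotient_topology X f =
     topology (\<lambda>U. U \<subseteq> f ` topspace X \<and> openin X {x \<in> topspace X. f x \<in> U})"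

lemma openin_quotient_topology:
  "openin (quotient_topology X f) U \<longleftrightarrow>
     U \<subseteq> f ` topspace X \<and> openin X {x \<in> topspace X. f x \<in> U}"
proof -
  have "istopology (\<lambda>U. U \<subseteq> f ` topspace X \<and> openin X {x \<in> topspace X. f x \<in> U})"
    unfolding istopology_def
  proof (intro conjI allI impI)
    fix A B
    assume "A \<subseteq> f ` topspace X \<and> openin X {x \<in> topspace X. f x \<in> A}"
      and "B \<subseteq> f ` topspace X \<and> openin X {x \<in> topspace X. f x \<in> B}"
    moreover have "{x \<in> topspace X. f x \<in> A \<inter> B}
        = {x \<in> topspace X. f x \<in> A} \<inter> {x \<in> topspace X. f x \<in> B}" by auto
    ultimately show "A \<inter> B \<subseteq> f ` topspace X" "openin X {x \<in> topspace X. f x \<in> A \<inter> B}"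
      by auto
  next
    fix K
    assume K: "\<forall>A\<in>K. A \<subseteq> f ` topspace X \<and> openin X {x \<in> topspace X. f x \<in> A}"
    then show "\<Union>K \<subseteq> f ` topspace X" by auto
    have "{x \<in> topspace X. f x \<in> \<Union>K} = (\<Union>A\<in>K. {x \<in> topspace X. f x \<in> A})" by auto
    with K show "openin X {x \<in> topspace X. f x \<in> \<Union>K}" by auto
  qed
  then show ?thesis
    by (simp add: quotient_topology_def)
qed

lemma topspace_quotient_topology [simp]: "topspace (quotient_topology X f) = f ` topspace X"
proof (rule subset_antisym)
  show "topspace (quotient_topology X f) \<subseteq> f ` topspace X"
    using openin_quotient_topology[of X f] openin_topspace by blast
  have "{x \<in> topspace X. f x \<in> f ` topspace X} = topspace X" by auto
  then show "f ` topspace X \<subseteq> topspace (quotient_topology X f)"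
    by (intro openin_subset) (simp add: openin_quotient_topology)
qed

lemma quotient_map_quotient_topology: "quotient_map X (quotient_topology X f) f"
  by (auto simp: quotient_map_def openin_quotient_topology)

definition surface :: "real \<Rightarrow> spoint topology" where
  "surface c = quotient_topology (pieces c) (cls c)"

lemma topspace_surface [simp]: "topspace (surface c) = S_pts c"
  by (simp add: surface_def S_pts_def)

definition Q_img :: "real \<Rightarrow> half \<Rightarrow> spoint set" where
  "Q_img c s = cls c ` ({s} \<times> polygon c s)"

definition Sigma_sing :: "real \<Rightarrow> spoint set" where
  "Sigma_sing c = (\<lambda>k. cls c (Plus, P_orb c k)) ` UNIV \<union> (\<lambda>k. cls c (Minus, - P_orb c k)) ` UNIV"

definition B_bundle :: "(real \<times> spoint) set" where
  "B_bundle = Sigma {1..} (\<lambda>c. S_pts c - Sigma_sing c)"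

text \<open>
  The bundle is glued, fibre by fibre, from two subsets of three-space (with coordinates the
  parameter and the two plane coordinates), and it carries the gluing metric: the distance is the
  infimum of the total Euclidean length of finite chains of steps, each step staying in one of the
  two subsets. Over the interiors of the polygons this is locally the metric of three-space.
  Across the glued faces the identification \<open>(c, p) \<mapsto> (c, p - P_orb c k - P_orb c (k + 1))\<close>
  translates by an amount depending on \<open>c\<close> (except when \<open>k\<close> is \<open>-1\<close> or \<open>0\<close>) and so is not an isometry;
  no metric is Euclidean in the coordinates of both sides. There the gluing metric still induces
  the topology for which local translation coordinates together with \<open>c\<close> are homeomorphisms
  to subsets of three-space.
\<close>
definition sheet :: "half \<Rightarrow> (real \<times> plane) set" where
  "sheet s = {(c, p). 1 \<le> c \<and> p \<in> polygon c s \<and> cls c (s, p) \<notin> Sigma_sing c}"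

definition B_proj :: "half \<Rightarrow> real \<times> plane \<Rightarrow> real \<times> spoint" where
  "B_proj s = (\<lambda>(c, p). (c, cls c (s, p)))"

inductive B_chain :: "real \<times> spoint \<Rightarrow> real \<times> spoint \<Rightarrow> real \<Rightarrow> bool" where
  refl: "b \<in> B_bundle \<Longrightarrow> B_chain b b 0"
| step: "B_chain b (B_proj s u) l \<Longrightarrow> u \<in> sheet s \<Longrightarrow> v \<in> sheet s \<Longrightarrow>
           B_chain b (B_proj s v) (l + dist u v)"

definition bundle_dist :: "real \<times> spoint \<Rightarrow> real \<times> spoint \<Rightarrow> real" where
  "bundle_dist a b = (if a \<in> B_bundle \<and> b \<in> B_bundle then Inf {l. B_chain a b l} else 0)"

definition bundle_topology :: "(real \<times> spoint) topology" where
  "bundle_topology = Metric_space.mtopology B_bundle bundle_dist"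

end

theory Submission
  imports Defs
begin

text \<open>
  For every \<open>c \<ge> 1\<close> the abscissae of the orbit points increase by at least \<open>1\<close> at each step, and each
  line through two consecutive orbit points supports the whole orbit. So \<open>Q_plus c\<close> is the region on
  and above the graph traced by the polygonal path through the orbit. Let this path reach
  \<open>P_orb c k\<close> at time \<open>k\<close> and move at constant velocity in between. The time \<open>t\<close> at which the path is
  vertically below (or above) a point and the height \<open>u\<close> of the point over the path are coordinates
  on the plane, in which \<open>Q_plus c\<close> is the half plane \<open>u \<ge> 0\<close> whatever \<open>c\<close> is. In these coordinates, with \<open>Q_minus c\<close>
  read off through \<open>p \<mapsto> - p\<close>, the \<open>k\<close>-th gluing is \<open>(t, 0) \<mapsto> (2 k + 1 - t, 0)\<close>
  for \<open>t\<close> between \<open>k\<close> and \<open>k + 1\<close>. It does not mention \<open>c\<close> either. Identifying points with equal coordinates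
  (\<open>transfer_piece\<close>) is therefore compatible with the gluings and gives the homeomorphisms;
  the cocycle identities and the images of the polygons and of the singular points are immediate.

  Continuity over the bundle has two ingredients. One is that the coordinates and their inverse are
  jointly continuous in the point and in \<open>c\<close>. The inverse is controlled because the
  horizontal speed of the path is at least \<open>1\<close>, so that it cannot magnify errors
  (\<open>fst_boundary_path_dist\<close>). The other is that the gluing metric sees no shortcuts: nearby points have
  nearby representatives in a common sheet (\<open>bundle_dist_small_same_sheet\<close>). The danger is
  a chain that crosses an edge many times, because the gluing translation
  depends on \<open>c\<close> and is not an isometry. The remedy is to unfold both sides of the edge into a single
  copy of three-space by the gluing shear. The orbit points are polynomials in \<open>c\<close>, so this shear is
  Lipschitz for bounded \<open>c\<close>, and it is the same at every crossing; so an unfolded chain is longer than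
  the original by at most a constant factor, no matter how often it crosses.
\<close>

section \<open>The orbit of the origin\<close>

lemma P_orb_0 [simp]: "P_orb c 0 = (0, 0)"
  by (simp add: P_orb_def)

lemma P_orb_succ: "P_orb c (k + 1) = T_map c (P_orb c k)"
proof (cases "0 \<le> k")
  case True
  then show ?thesis
    by (simp add: P_orb_def nat_add_distrib)
next
  case False
  define n where "n = nat (- (k + 1))"
  have k: "k = - int n - 1"
    using False by (simp add: n_def)
  have "P_orb c (k + 1) = (inv (T_map c) ^^ n) (0, 0)"
    by (cases "n = 0") (auto simp: k P_orb_def)
  moreover have "P_orb c k = inv (T_map c) ((inv (T_map c) ^^ n) (0, 0))"
  proof -
    have "nat (- k) = Suc n"
      using False by (simp add: k)
    then show ?thesis
      using False by (simp add: P_orb_def)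
  qed
  ultimately show ?thesis
    using bij_T_map[of c] by (simp add: bij_is_surj surj_f_inv_f)
qed

lemma fst_P_orb_succ: "fst (P_orb c (k + 1)) = c * fst (P_orb c k) + (c - 1) * snd (P_orb c k) + 1"
  and snd_P_orb_succ: "snd (P_orb c (k + 1)) = (c + 1) * fst (P_orb c k) + c * snd (P_orb c k) + 1"
  by (simp_all add: P_orb_succ T_map_def case_prod_unfold)

lemma P_orb_1 [simp]: "P_orb c 1 = (1, 1)"
  using P_orb_succ[of c 0] by (simp add: T_map_def)

text \<open>
  The reflection in the vertical axis conjugates \<open>T_map c\<close> to its inverse and fixes the origin, so it
  reverses the orbit.
\<close>

lemma P_orb_uminus_nat: "P_orb c (- int n) = (- fst (P_orb c (int n)), snd (P_orb c (int n)))"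
proof (induction n)
  case 0
  then show ?case by simp
next
  case (Suc n)
  let ?r = "(- fst (P_orb c (int (Suc n))), snd (P_orb c (int (Suc n))))"
  have "T_map c (P_orb c (- int (Suc n))) = P_orb c (- int n)"
    using P_orb_succ[of c "- int (Suc n)"] by (simp add: algebra_simps)
  also have "\<dots> = T_map c ?r"
    using fst_P_orb_succ[of c "int n"] snd_P_orb_succ[of c "int n"]
    by (simp add: Suc T_map_def add.commute[of 1]) (simp add: algebra_simps)
  finally show ?case
    using bij_T_map[of c] by (metis bij_is_inj injD)
qed

lemma P_orb_uminus: "P_orb c (- k) = (- fst (P_orb c k), snd (P_orb c k))"
proof (cases k rule: int_cases2)
  case (nonneg n)
  then show ?thesis by (simp add: P_orb_uminus_nat)
next
  case (nonpos n)
  then show ?thesis by (simp add: P_orb_uminus_nat)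
qed

lemma P_orb_nat_ge:
  assumes "1 \<le> c"
  shows "real n \<le> fst (P_orb c (int n)) \<and> real n \<le> snd (P_orb c (int n))"
proof (induction n)
  case 0
  then show ?case by simp
next
  case (Suc n)
  let ?x = "fst (P_orb c (int n))" and ?y = "snd (P_orb c (int n))"
  have xy: "real n \<le> ?x" "real n \<le> ?y" "0 \<le> ?x" "0 \<le> ?y"
    using Suc by linarith+
  have "0 \<le> (c - 1) * ?x" "0 \<le> (c - 1) * ?y"
    using xy assms by simp_all
  then show ?case
    using xy fst_P_orb_succ[of c "int n"] snd_P_orb_succ[of c "int n"]
    by (simp add: add.commute[of 1]) (simp add: algebra_simps)
qed

lemma P_orb_ge:
  assumes "1 \<le> c" "0 \<le> k"
  shows "real_of_int k \<le> fst (P_orb c k)" "real_of_int k \<le> snd (P_orb c k)"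
  using P_orb_nat_ge[OF assms(1), of "nat k"] assms(2) by simp_all

text \<open>
  The gap is \<open>(c - 1) (x + y) + 1\<close> for a point \<open>(x, y)\<close> of the orbit, and \<open>x + y \<ge> 0\<close> on the forward orbit;
  the reflection takes care of the backward orbit.
\<close>

lemma fst_P_orb_gap:
  assumes "1 \<le> c"
  shows "fst (P_orb c k) + 1 \<le> fst (P_orb c (k + 1))"
proof -
  have gap: "fst (P_orb c k) + 1 \<le> fst (P_orb c (k + 1))" if "0 \<le> k" for k
  proof -
    have "0 \<le> (c - 1) * (fst (P_orb c k) + snd (P_orb c k))"
      using P_orb_ge[OF assms that] assms that by (intro mult_nonneg_nonneg) auto
    then show ?thesis
      unfolding fst_P_orb_succ by (simp add: algebra_simps)
  qed
  show ?thesis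
  proof (cases "0 \<le> k")
    case False
    then show ?thesis
      using gap[of "- k - 1"] P_orb_uminus[of c k] P_orb_uminus[of c "k + 1"] by simp
  qed (rule gap)
qed

lemma fst_P_orb_le_snd:
  assumes "1 \<le> c"
  shows "fst (P_orb c k) \<le> snd (P_orb c k)"
proof (cases "1 \<le> k")
  case True
  have "snd (P_orb c k) - fst (P_orb c k) = fst (P_orb c (k - 1)) + snd (P_orb c (k - 1))"
    using fst_P_orb_succ[of c "k - 1"] snd_P_orb_succ[of c "k - 1"] by (simp add: algebra_simps)
  then show ?thesis
    using P_orb_ge[OF assms, of "k - 1"] True by simp
next
  case False
  then show ?thesis
    using P_orb_ge[OF assms, of "- k"] P_orb_uminus[of c k] by simp
qed

section \<open>The half planes that cut out the polygon\<close>

text \<open>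
  The cross product of the \<open>k\<close>-th edge vector with the vector from \<open>P_orb c k\<close> to \<open>p\<close>: it is nonnegative on
  the side of the edge on which the polygon lies.
\<close>

definition side_form :: "real \<Rightarrow> int \<Rightarrow> plane \<Rightarrow> real" where
  "side_form c k p =
     (fst (P_orb c (k + 1)) - fst (P_orb c k)) * (snd p - snd (P_orb c k))
     - (snd (P_orb c (k + 1)) - snd (P_orb c k)) * (fst p - fst (P_orb c k))"

text \<open>
  The linear part of \<open>T_map c\<close> has determinant \<open>1\<close>, so \<open>T_map c\<close> preserves this area form and the \<open>k\<close>-th
  edge can be moved back to the edge from \<open>(0, 0)\<close> to \<open>(1, 1)\<close>.
\<close>

lemma side_form_P_orb: "side_form c k (P_orb c j) = snd (P_orb c (j - k)) - fst (P_orb c (j - k))"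
proof -
  have step: "side_form c (i + 1) (P_orb c (j + 1)) = side_form c i (P_orb c j)" for i j
    unfolding side_form_def fst_P_orb_succ snd_P_orb_succ by algebra
  have pos: "side_form c (i + int n) (P_orb c (j + int n)) = side_form c i (P_orb c j)" for i j n
  proof (induction n)
    case (Suc n)
    then show ?case
      using step[of "i + int n" "j + int n"] by (simp add: algebra_simps)
  qed simp
  have "side_form c k (P_orb c j) = side_form c 0 (P_orb c (j - k))"
  proof (cases k rule: int_cases2)
    case (nonneg n)
    then show ?thesis using pos[of 0 n "j - k"] by simp
  next
    case (nonpos n)
    then show ?thesis using pos[of k n j] by simp
  qed
  then show ?thesis by (simp add: side_form_def)
qed

lemma convex_side_form_nonneg: "convex {p. 0 \<le> side_form c k p}"
proof -
  let ?a = "(- (snd (P_orb c (k + 1)) - snd (P_orb c k)), fst (P_orb c (k + 1)) - fst (P_orb c k))"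
  have "{p. 0 \<le> side_form c k p} = {p. ?a \<bullet> p \<ge> ?a \<bullet> P_orb c k}"
    by (auto simp: side_form_def inner_prod_def algebra_simps)
  then show ?thesis
    using convex_halfspace_ge by metis
qed

lemma side_form_nonneg:
  assumes "1 \<le> c" "p \<in> Q_plus c"
  shows "0 \<le> side_form c k p"
proof -
  have "Q_plus c \<subseteq> {p. 0 \<le> side_form c k p}"
    unfolding Q_plus_def
    using fst_P_orb_le_snd[OF assms(1)]
    by (intro hull_minimal convex_side_form_nonneg) (auto simp: side_form_P_orb)
  then show ?thesis using assms(2) by auto
qed

section \<open>The boundary path\<close>

definition boundary_path :: "real \<Rightarrow> real \<Rightarrow> plane" where
  "boundary_path c t = P_orb c \<lfloor>t\<rfloor> + frac t *\<^sub>R (P_orb c (\<lfloor>t\<rfloor> + 1) - P_orb c \<lfloor>t\<rfloor>)"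

text \<open>
  The formula is also valid at the right end of the edge, where \<open>floor\<close> and \<open>frac\<close> in the definition
  already refer to the next edge.
\<close>

lemma boundary_path_on_edge:
  assumes "real_of_int k \<le> t" "t \<le> real_of_int k + 1"
  shows "boundary_path c t = P_orb c k + (t - k) *\<^sub>R (P_orb c (k + 1) - P_orb c k)"
proof (cases "t = real_of_int k + 1")
  case True
  then have "\<lfloor>t\<rfloor> = k + 1" "frac t = 0" by (simp_all add: frac_def)
  with True show ?thesis by (simp add: boundary_path_def)
next
  case False
  then have "\<lfloor>t\<rfloor> = k" using assms by linarith
  then show ?thesis by (simp add: boundary_path_def frac_def)
qed

lemma boundary_path_of_int [simp]: "boundary_path c (of_int k) = P_orb c k"
  by (simp add: boundary_path_def)

lemma edge_eq_boundary_path: "edge c k = boundary_path c ` {of_int k..of_int k + 1}"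
proof -
  have "edge c k = (\<lambda>v. P_orb c k + v *\<^sub>R (P_orb c (k + 1) - P_orb c k)) ` {0..1}"
    unfolding edge_def closed_segment_def by (auto simp: algebra_simps)
  also have "{0..1} = (\<lambda>t. t - real_of_int k) ` {of_int k..of_int k + 1}"
    by (simp add: image_diff_atLeastAtMost)
  also have "(\<lambda>v. P_orb c k + v *\<^sub>R (P_orb c (k + 1) - P_orb c k)) ` \<dots> = boundary_path c ` {of_int k..of_int k + 1}"
    unfolding image_image by (intro image_cong refl boundary_path_on_edge[symmetric]) auto
  finally show ?thesis .
qed

text \<open>
  Up to the sign change that identifies the two polygons, this is the gluing of the \<open>k\<close>-th edge:
  it reverses the time on the edge.
\<close>

lemma boundary_path_reflect:
  assumes "real_of_int k \<le> t" "t \<le> real_of_int k + 1"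
  shows "boundary_path c (2 * k + 1 - t) = P_orb c k + P_orb c (k + 1) - boundary_path c t"
proof -
  have "boundary_path c (2 * k + 1 - t) = P_orb c k + (2 * k + 1 - t - k) *\<^sub>R (P_orb c (k + 1) - P_orb c k)"
    using assms by (intro boundary_path_on_edge) auto
  then show ?thesis
    unfolding boundary_path_on_edge[OF assms] by (simp add: algebra_simps)
qed

text \<open>
  On each edge the abscissa is affine in \<open>t\<close> with slope equal to the gap between two orbit points, and
  that gap is at least \<open>1\<close>. So abscissa minus \<open>t\<close> is nondecreasing at the integers and on each edge,
  hence everywhere.
\<close>

lemma fst_boundary_path_expands:
  assumes "1 \<le> c" "t \<le> t'"
  shows "t' - t \<le> fst (boundary_path c t') - fst (boundary_path c t)"
proof -
  let ?x = "\<lambda>k. fst (P_orb c k)"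
  have vert: "?x m - m \<le> ?x n - n" if "m \<le> n" for m n :: int
    using that
  proof (induction n rule: int_ge_induct)
    case (step i)
    then show ?case using fst_P_orb_gap[OF assms(1), of i] by simp
  qed simp
  have gap: "0 \<le> ?x (k + 1) - ?x k - 1" for k
    using fst_P_orb_gap[OF assms(1), of k] by simp
  have path: "fst (boundary_path c s) - s
      = ?x \<lfloor>s\<rfloor> - \<lfloor>s\<rfloor> + frac s * (?x (\<lfloor>s\<rfloor> + 1) - ?x \<lfloor>s\<rfloor> - 1)" for s
    by (simp add: boundary_path_def frac_def algebra_simps)
  have lower: "?x \<lfloor>s\<rfloor> - \<lfloor>s\<rfloor> \<le> fst (boundary_path c s) - s" for s
    unfolding path using gap[of "\<lfloor>s\<rfloor>"] by simp
  have upper: "fst (boundary_path c s) - s \<le> ?x (\<lfloor>s\<rfloor> + 1) - (\<lfloor>s\<rfloor> + 1)" for s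
    unfolding path using mult_right_mono[OF less_imp_le[OF frac_lt_1[of s]] gap[of "\<lfloor>s\<rfloor>"]] by simp
  show ?thesis
  proof (cases "\<lfloor>t\<rfloor> = \<lfloor>t'\<rfloor>")
    case True
    then have "frac t \<le> frac t'" using assms(2) by (simp add: frac_def)
    then show ?thesis
      using path[of t] path[of t'] mult_right_mono[OF _ gap[of "\<lfloor>t\<rfloor>"], of "frac t" "frac t'"] True
      by simp
  next
    case False
    then have "\<lfloor>t\<rfloor> + 1 \<le> \<lfloor>t'\<rfloor>" using floor_mono[OF assms(2)] by simp
    then show ?thesis using upper[of t] vert[of "\<lfloor>t\<rfloor> + 1" "\<lfloor>t'\<rfloor>"] lower[of t'] by simp
  qed
qed

lemma fst_boundary_path_dist:
  assumes "1 \<le> c"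
  shows "\<bar>t - t'\<bar> \<le> \<bar>fst (boundary_path c t) - fst (boundary_path c t')\<bar>"
  using fst_boundary_path_expands[OF assms, of t t'] fst_boundary_path_expands[OF assms, of t' t]
  by linarith

section \<open>Dependence on the parameter\<close>

lemma P_orb_poly: "\<exists>p q. \<forall>c. P_orb c k = (poly p c, poly q c)"
proof -
  have nat: "\<exists>p q. \<forall>c. P_orb c (int n) = (poly p c, poly q c)" for n
  proof (induction n)
    case 0
    show ?case by (intro exI[of _ 0]) simp
  next
    case (Suc n)
    then obtain p q where pq: "P_orb c (int n) = (poly p c, poly q c)" for c
      by blast
    let ?p = "[:0, 1:] * p + [:-1, 1:] * q + 1" and ?q = "[:1, 1:] * p + [:0, 1:] * q + 1"
    have "P_orb c (int (Suc n)) = (poly ?p c, poly ?q c)" for c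
      using P_orb_succ[of c "int n"] pq[of c]
      by (simp add: T_map_def algebra_simps)
    then show ?case by blast
  qed
  show ?thesis
  proof (cases k rule: int_cases2)
    case (nonneg n)
    then show ?thesis using nat by simp
  next
    case (nonpos n)
    obtain p q where "P_orb c (int n) = (poly p c, poly q c)" for c
      using nat by blast
    then have "P_orb c k = (poly (- p) c, poly q c)" for c
      by (simp add: nonpos P_orb_uminus)
    then show ?thesis by blast
  qed
qed

lemma continuous_on_P_orb [continuous_intros]:
  assumes "continuous_on A f"
  shows "continuous_on A (\<lambda>z. P_orb (f z) k)"
proof -
  obtain p q where "P_orb c k = (poly p c, poly q c)" for c
    using P_orb_poly by blast
  then show ?thesis
    using assms by (auto intro!: continuous_intros)
qed

lemma poly_lipschitz_on_interval: "\<exists>K. K-lipschitz_on {a..b} (poly (p :: real poly))"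
proof -
  have "bounded (poly (pderiv p) ` {a..b})"
    by (intro compact_imp_bounded compact_continuous_image continuous_intros) auto
  then obtain B where B: "B > 0" "\<And>x. x \<in> {a..b} \<Longrightarrow> norm (poly (pderiv p) x) \<le> B"
    unfolding bounded_pos by blast
  have "B-lipschitz_on {a..b} (poly p)"
  proof (rule lipschitz_onI)
    fix x y assume xy: "x \<in> {a..b}" "y \<in> {a..b}"
    have "norm (poly p x - poly p y) \<le> B * norm (x - y)"
      by (rule field_differentiable_bound[OF _ _ B(2) xy])
         (auto intro: DERIV_subset poly_DERIV)
    then show "dist (poly p x) (poly p y) \<le> B * dist x y"
      by (simp add: dist_norm)
  qed (use B in simp)
  then show ?thesis by blast
qed

lemma P_orb_lipschitz_on_interval: "\<exists>K. K-lipschitz_on {a..b} (\<lambda>c. P_orb c k)"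
proof -
  obtain p q where "P_orb c k = (poly p c, poly q c)" for c
    using P_orb_poly by blast
  moreover obtain K L where "K-lipschitz_on {a..b} (poly p)" "L-lipschitz_on {a..b} (poly q)"
    using poly_lipschitz_on_interval by meson
  ultimately show ?thesis
    using lipschitz_on_Pair[of K "{a..b}" "poly p" L "poly q"] by auto
qed

text \<open>
  On each closed edge the path is given by one formula. Around any time the two closed edges
  adjacent to it cover a neighbourhood, so continuity on both is enough.
\<close>

lemma continuous_on_boundary_path [continuous_intros]:
  assumes "continuous_on A f" "continuous_on A g"
  shows "continuous_on A (\<lambda>z. boundary_path (f z) (g z))"
proof -
  have on_edge: "continuous_on (UNIV \<times> {of_int k..of_int k + 1}) (\<lambda>(c, t). boundary_path c t)" for k
  proof (rule continuous_on_eq)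
    show "continuous_on (UNIV \<times> {of_int k..of_int k + 1})
      (\<lambda>z. P_orb (fst z) k + (snd z - of_int k) *\<^sub>R (P_orb (fst z) (k + 1) - P_orb (fst z) k))"
      by (intro continuous_intros)
  qed (auto simp: boundary_path_on_edge)
  have "isCont (\<lambda>(c, t). boundary_path c t) (c0, t0)" for c0 t0
  proof -
    define k where "k = \<lfloor>t0\<rfloor>"
    have "continuous_on (UNIV \<times> {of_int (k - 1)..of_int (k - 1) + 1} \<union> UNIV \<times> {of_int k..of_int k + 1})
        (\<lambda>(c, t). boundary_path c t)"
      by (intro continuous_on_closed_Un on_edge closed_Times) simp_all
    moreover have "UNIV \<times> {of_int (k - 1)..of_int (k - 1) + 1} \<union> UNIV \<times> {of_int k..of_int k + 1}
        = UNIV \<times> {of_int (k - 1)..real_of_int k + 1}"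
      by auto
    ultimately have "continuous_on (UNIV \<times> {of_int (k - 1)..of_int k + 1}) (\<lambda>(c, t). boundary_path c t)"
      by metis
    then show ?thesis
    proof (rule continuous_on_interior)
      have "t0 \<in> {of_int (k - 1)<..<of_int k + 1}"
        unfolding k_def using floor_correct[of t0] by (simp del: floor_le_iff) linarith
      then show "(c0, t0) \<in> interior (UNIV \<times> {of_int (k - 1)..of_int k + 1})"
        by (simp add: interior_Times)
    qed
  qed
  then have "continuous_on UNIV (\<lambda>(c, t). boundary_path c t)"
    by (intro continuous_at_imp_continuous_on) auto
  from continuous_on_compose2[OF this continuous_on_Pair[OF assms]] show ?thesis
    by simp
qed

lemma fst_boundary_path_surj:
  assumes "1 \<le> c"
  shows "\<exists>t. fst (boundary_path c t) = x"
proof -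
  have cont: "continuous_on S (\<lambda>t. fst (boundary_path c t))" for S
    by (intro continuous_intros)
  have 0: "fst (boundary_path c 0) = 0"
    using boundary_path_of_int[of c 0] by simp
  show ?thesis
  proof (cases "0 \<le> x")
    case True
    then show ?thesis
      using IVT'[of "\<lambda>t. fst (boundary_path c t)" 0 x x] fst_boundary_path_expands[OF assms, of 0 x] 0 cont
      by auto
  next
    case False
    then show ?thesis
      using IVT'[of "\<lambda>t. fst (boundary_path c t)" x x 0] fst_boundary_path_expands[OF assms, of x 0] 0 cont
      by auto
  qed
qed

definition boundary_param :: "real \<Rightarrow> real \<Rightarrow> real" where
  "boundary_param c x = (THE t. fst (boundary_path c t) = x)"

lemma boundary_param_fst_path [simp]:
  assumes "1 \<le> c"
  shows "boundary_param c (fst (boundary_path c t)) = t"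
  unfolding boundary_param_def
proof (rule the_equality)
  fix t' assume "fst (boundary_path c t') = fst (boundary_path c t)"
  then show "t' = t" using fst_boundary_path_dist[OF assms, of t' t] by simp
qed simp

lemma fst_path_boundary_param [simp]:
  assumes "1 \<le> c"
  shows "fst (boundary_path c (boundary_param c x)) = x"
  using fst_boundary_path_surj[OF assms, of x] boundary_param_fst_path[OF assms] by auto

text \<open>
  Let \<open>t0\<close> be the value at \<open>(c0, x0)\<close>. As time differences are at most differences of abscissae,
  the value at \<open>(c, x)\<close> differs from \<open>t0\<close> by at most the distance from \<open>x\<close> to the abscissa of
  \<open>boundary_path c t0\<close>. In this bound the time is fixed, so continuity of the path in \<open>c\<close> alone suffices.
\<close>

lemma continuous_on_boundary_param_pair:
  "continuous_on ({1..} \<times> UNIV) (\<lambda>(c, x). boundary_param c x)"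
  unfolding continuous_on_def
proof
  fix z0 :: "real \<times> real" assume "z0 \<in> {1..} \<times> UNIV"
  then obtain c0 x0 where z0: "z0 = (c0, x0)" and c0: "1 \<le> c0" by auto
  define t0 where "t0 = boundary_param c0 x0"
  have "continuous_on ({1..} \<times> UNIV) (\<lambda>z. snd z - fst (boundary_path (fst z) t0))"
    by (intro continuous_intros)
  from this[unfolded continuous_on_def, rule_format, OF \<open>z0 \<in> {1..} \<times> UNIV\<close>]
  have "((\<lambda>z. snd z - fst (boundary_path (fst z) t0)) \<longlongrightarrow> x0 - fst (boundary_path c0 t0))
      (at z0 within {1..} \<times> UNIV)"
    by (simp add: z0)
  then have lim: "((\<lambda>z. snd z - fst (boundary_path (fst z) t0)) \<longlongrightarrow> 0) (at z0 within {1..} \<times> UNIV)"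
    using c0 by (simp add: t0_def)
  have "((\<lambda>z. boundary_param (fst z) (snd z) - t0) \<longlongrightarrow> 0) (at z0 within {1..} \<times> UNIV)"
  proof (rule Lim_null_comparison[OF _ tendsto_norm_zero[OF lim]])
    have "\<bar>boundary_param c x - t0\<bar> \<le> \<bar>x - fst (boundary_path c t0)\<bar>" if "1 \<le> c" for c x
      using fst_boundary_path_dist[OF that, of "boundary_param c x" t0] that by simp
    then show "\<forall>\<^sub>F z in at z0 within {1..} \<times> UNIV. norm (boundary_param (fst z) (snd z) - t0)
        \<le> norm (snd z - fst (boundary_path (fst z) t0))"
      by (auto simp: eventually_at_filter intro!: always_eventually)
  qed
  then show "((\<lambda>(c, x). boundary_param c x) \<longlongrightarrow> (case z0 of (c, x) \<Rightarrow> boundary_param c x))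
      (at z0 within {1..} \<times> UNIV)"
    by (simp add: z0 t0_def case_prod_unfold flip: Lim_null)
qed

lemma continuous_on_boundary_param [continuous_intros]:
  assumes "continuous_on A f" "continuous_on A g" "\<And>z. z \<in> A \<Longrightarrow> 1 \<le> f z"
  shows "continuous_on A (\<lambda>z. boundary_param (f z) (g z))"
proof -
  have "(\<lambda>z. (f z, g z)) ` A \<subseteq> {1..} \<times> UNIV"
    using assms(3) by auto
  from continuous_on_compose2[OF continuous_on_boundary_param_pair continuous_on_Pair[OF assms(1,2)] this]
  show ?thesis by simp
qed

section \<open>Coordinates in which the polygon is a half plane\<close>

definition strip_to_hull :: "real \<Rightarrow> real \<times> real \<Rightarrow> plane" where
  "strip_to_hull c = (\<lambda>(t, u). boundary_path c t + (0, u))"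

definition hull_to_strip :: "real \<Rightarrow> plane \<Rightarrow> real \<times> real" where
  "hull_to_strip c p =
     (let t = boundary_param c (fst p) in (t, snd p - snd (boundary_path c t)))"

lemma hull_to_strip_to_hull [simp]: "1 \<le> c \<Longrightarrow> hull_to_strip c (strip_to_hull c w) = w"
  by (simp add: strip_to_hull_def hull_to_strip_def Let_def case_prod_unfold)

lemma strip_to_hull_to_strip [simp]: "1 \<le> c \<Longrightarrow> strip_to_hull c (hull_to_strip c p) = p"
  by (simp add: strip_to_hull_def hull_to_strip_def Let_def prod_eq_iff)

lemma continuous_on_strip_to_hull [continuous_intros]:
  assumes "continuous_on A f" "continuous_on A g"
  shows "continuous_on A (\<lambda>z. strip_to_hull (f z) (g z))"
  unfolding strip_to_hull_def case_prod_unfold using assms by (intro continuous_intros)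

lemma continuous_on_hull_to_strip [continuous_intros]:
  assumes "continuous_on A f" "continuous_on A g" "\<And>z. z \<in> A \<Longrightarrow> 1 \<le> f z"
  shows "continuous_on A (\<lambda>z. hull_to_strip (f z) (g z))"
  unfolding hull_to_strip_def Let_def using assms by (intro continuous_intros)

lemma convex_horizontal:
  fixes S :: "plane set"
  assumes "convex S" "(a, y) \<in> S" "(b, y) \<in> S" "a \<le> x" "x \<le> b"
  shows "(x, y) \<in> S"
proof -
  have "convex ((\<lambda>s. (s, 0)) -` ((+) (- (0, y)) ` S))"
    by (intro convex_linear_vimage convex_translation assms(1)) (simp add: linear_iff)
  moreover have "(\<lambda>s. (s, 0)) -` ((+) (- (0, y)) ` S) = {s. (s, y) \<in> S}"
    by (force simp: image_iff)
  ultimately have "closed_segment a b \<subseteq> {s. (s, y) \<in> S}"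
    using assms by (intro closed_segment_subset) auto
  then show ?thesis using assms by (auto simp: closed_segment_eq_real_ivl)
qed

lemma convex_vertical:
  fixes S :: "plane set"
  assumes "convex S" "(x, a) \<in> S" "(x, b) \<in> S" "a \<le> y" "y \<le> b"
  shows "(x, y) \<in> S"
proof -
  have "convex ((\<lambda>s. (0, s)) -` ((+) (- (x, 0)) ` S))"
    by (intro convex_linear_vimage convex_translation assms(1)) (simp add: linear_iff)
  moreover have "(\<lambda>s. (0, s)) -` ((+) (- (x, 0)) ` S) = {s. (x, s) \<in> S}"
    by (force simp: image_iff)
  ultimately have "closed_segment a b \<subseteq> {s. (x, s) \<in> S}"
    using assms by (intro closed_segment_subset) auto
  then show ?thesis using assms by (auto simp: closed_segment_eq_real_ivl)
qed

lemma edge_subset_Q_plus: "edge c k \<subseteq> Q_plus c"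
  unfolding edge_def Q_plus_def
  by (intro closed_segment_subset convex_convex_hull hull_inc) auto

lemma boundary_path_in_edge: "boundary_path c t \<in> edge c \<lfloor>t\<rfloor>"
  unfolding edge_eq_boundary_path using floor_correct[of t] by (intro imageI) simp

text \<open>
  The polygon lies above each of its edge lines; this gives one direction. Conversely, by
  the symmetry of the orbit, \<open>P_orb c n\<close> and \<open>P_orb c (- n)\<close> have the same height, so for \<open>n\<close> large a
  horizontal chord of the hull passes above a given point. If the point is also on or above the boundary path, it
  lies on a vertical segment between two points of the hull.
\<close>

lemma Q_plus_iff_strip:
  assumes "1 \<le> c"
  shows "p \<in> Q_plus c \<longleftrightarrow> 0 \<le> snd (hull_to_strip c p)"
proof -
  obtain t u where tu: "hull_to_strip c p = (t, u)" by fastforce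
  have p: "p = boundary_path c t + (0, u)"
    using strip_to_hull_to_strip[OF assms, of p] by (simp add: tu strip_to_hull_def)
  show ?thesis
  proof
    assume "p \<in> Q_plus c"
    then have "0 \<le> side_form c \<lfloor>t\<rfloor> p"
      by (rule side_form_nonneg[OF assms])
    also have "side_form c \<lfloor>t\<rfloor> p = (fst (P_orb c (\<lfloor>t\<rfloor> + 1)) - fst (P_orb c \<lfloor>t\<rfloor>)) * u"
      unfolding p side_form_def boundary_path_def by (simp add: algebra_simps)
    finally show "0 \<le> snd (hull_to_strip c p)"
      using fst_P_orb_gap[OF assms, of "\<lfloor>t\<rfloor>"] by (simp add: tu zero_le_mult_iff)
  next
    assume "0 \<le> snd (hull_to_strip c p)"
    then have u: "0 \<le> u"
      by (simp add: tu)
    obtain n :: nat where n: "\<bar>fst p\<bar> \<le> real n" "snd p \<le> real n"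
      using real_arch_simple[of "max \<bar>fst p\<bar> (snd p)"] by auto
    have conv: "convex (Q_plus c)"
      by (simp add: Q_plus_def)
    have orb: "P_orb c k \<in> Q_plus c" for k
      by (simp add: Q_plus_def hull_inc)
    have Pn: "real n \<le> fst (P_orb c n)" "real n \<le> snd (P_orb c n)"
      using P_orb_ge[OF assms, of n] by auto
    have "(fst p, snd (P_orb c n)) \<in> Q_plus c"
    proof (rule convex_horizontal[OF conv])
      show "(- fst (P_orb c n), snd (P_orb c n)) \<in> Q_plus c" "(fst (P_orb c n), snd (P_orb c n)) \<in> Q_plus c"
        using orb[of "- int n"] orb[of n] by (simp_all add: P_orb_uminus_nat)
    qed (use n Pn in auto)
    moreover have "boundary_path c t \<in> Q_plus c"
      using edge_subset_Q_plus boundary_path_in_edge by blast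
    then have "(fst p, snd (boundary_path c t)) \<in> Q_plus c"
      using arg_cong[OF p, of fst] by simp
    moreover have "snd (boundary_path c t) \<le> snd p"
      using u arg_cong[OF p, of snd] by simp
    moreover have "snd p \<le> snd (P_orb c n)"
      using n Pn by linarith
    ultimately have "(fst p, snd p) \<in> Q_plus c"
      using convex_vertical[OF conv] by blast
    then show "p \<in> Q_plus c" by simp
  qed
qed

lemma mem_edge_iff_strip:
  assumes "1 \<le> c"
  shows "p \<in> edge c k \<longleftrightarrow> hull_to_strip c p \<in> {of_int k..of_int k + 1} \<times> {0}"
proof -
  have "p \<in> edge c k \<longleftrightarrow> p \<in> strip_to_hull c ` ({of_int k..of_int k + 1} \<times> {0})"
    unfolding edge_eq_boundary_path by (auto simp: strip_to_hull_def image_iff simp flip: zero_prod_def)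
  also have "\<dots> \<longleftrightarrow> hull_to_strip c p \<in> {of_int k..of_int k + 1} \<times> {0}"
    using assms by (metis (no_types, lifting) hull_to_strip_to_hull image_iff strip_to_hull_to_strip)
  finally show ?thesis .
qed

section \<open>The gluing in coordinates\<close>

text \<open>
  Multiplication by this sign identifies either polygon with \<open>Q_plus\<close> and lets both polygons be
  treated by the same formulas.
\<close>

fun half_sign :: "half \<Rightarrow> real" where
  "half_sign Plus = 1"
| "half_sign Minus = -1"

lemma half_sign_mult_self [simp]: "half_sign s * half_sign s = 1"
  by (cases s) simp_all

lemma half_sign_scaleR_cancel [simp]: "half_sign s *\<^sub>R half_sign s *\<^sub>R (p :: plane) = p"
  by simp

lemma half_sign_other: "s \<noteq> s' \<Longrightarrow> half_sign s' = - half_sign s"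
  by (cases s; cases s') simp_all

lemma mem_polygon_iff: "p \<in> polygon c s \<longleftrightarrow> half_sign s *\<^sub>R p \<in> Q_plus c"
  by (cases s) (auto simp: Q_minus_def image_iff, metis minus_minus)

lemma mem_polygon_iff_strip:
  "1 \<le> c \<Longrightarrow> p \<in> polygon c s \<longleftrightarrow> 0 \<le> snd (hull_to_strip c (half_sign s *\<^sub>R p))"
  by (simp add: mem_polygon_iff Q_plus_iff_strip)

lemma topspace_pieces: "topspace (pieces c) = {(s, p). p \<in> polygon c s}"
  by (auto simp: pieces_def)

text \<open>
  After symmetrization the gluing looks alike from both sides, so that no later argument has to distinguish
  the polygon on which a point starts.
\<close>

lemma symclp_glue_iff_edge:
  "symclp (glue c) (s, p) (s', p') \<longleftrightarrow>
     s \<noteq> s' \<and> (\<exists>k. half_sign s *\<^sub>R p \<in> edge c k \<and>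
       p' = p - half_sign s *\<^sub>R (P_orb c k + P_orb c (k + 1)))"
proof -
  have flip: "p = q + (- P_orb c k - P_orb c (k + 1)) \<and> q \<in> edge c k
      \<longleftrightarrow> - p \<in> edge c k \<and> q = p + P_orb c k + P_orb c (k + 1)" for p q k
  proof -
    have "(\<lambda>p. p + (- P_orb c k - P_orb c (k + 1))) ` edge c k = uminus ` edge c k"
      by (rule edge_translation)
    then have "q + (- P_orb c k - P_orb c (k + 1)) \<in> uminus ` edge c k \<longleftrightarrow> q \<in> edge c k"
      by (metis (no_types, lifting) add_right_imp_eq image_iff)
    moreover have "p = q + (- P_orb c k - P_orb c (k + 1)) \<longleftrightarrow> q = p + P_orb c k + P_orb c (k + 1)"
      by (auto simp: algebra_simps)
    moreover have "p \<in> uminus ` edge c k \<longleftrightarrow> - p \<in> edge c k"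
      by (metis image_iff minus_minus)
    ultimately show ?thesis by metis
  qed
  have minus_plus: "glue c (Plus, q) (Minus, p)
      \<longleftrightarrow> (\<exists>k. - p \<in> edge c k \<and> q = p + P_orb c k + P_orb c (k + 1))" for p q
    unfolding glue.simps using flip by auto
  have plus_minus: "glue c (Plus, p) (Minus, q)
      \<longleftrightarrow> (\<exists>k. p \<in> edge c k \<and> q = p - (P_orb c k + P_orb c (k + 1)))" for p q
    unfolding glue.simps by (auto simp: algebra_simps)
  have only: "\<not> glue c (s, p) (s, q)" "\<not> glue c (Minus, p) (Plus, q)" for s p q
    by (auto simp: glue.simps)
  show ?thesis
  proof (cases s; cases s')
    assume "s = Plus" "s' = Minus"
    then show ?thesis by (simp add: symclp_def only plus_minus)
  next
    assume "s = Minus" "s' = Plus"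
    then show ?thesis by (simp add: symclp_def only minus_plus algebra_simps)
  qed (simp_all add: symclp_def only)
qed

text \<open>
  The right-hand side mentions \<open>c\<close> only through \<open>boundary_path c\<close>: this is why the correspondence between
  boundary paths respects the gluings.
\<close>

lemma symclp_glue_iff_boundary_path:
  "symclp (glue c) (s, p) (s', p') \<longleftrightarrow>
     s \<noteq> s' \<and> (\<exists>k t. of_int k \<le> t \<and> t \<le> of_int k + 1 \<and>
       half_sign s *\<^sub>R p = boundary_path c t \<and>
       half_sign s' *\<^sub>R p' = boundary_path c (2 * of_int k + 1 - t))"
proof (cases "s = s'")
  case False
  have partner: "p' = p - half_sign s *\<^sub>R (P_orb c k + P_orb c (k + 1))
      \<longleftrightarrow> half_sign s' *\<^sub>R p' = boundary_path c (2 * of_int k + 1 - t)"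
    if "of_int k \<le> t" "t \<le> of_int k + 1" "half_sign s *\<^sub>R p = boundary_path c t" for k t
    unfolding boundary_path_reflect[OF that(1,2)] that(3)[symmetric]
    using False by (cases s; cases s') (auto simp: algebra_simps minus_equation_iff[of p'])
  have "(half_sign s *\<^sub>R p \<in> edge c k \<and> p' = p - half_sign s *\<^sub>R (P_orb c k + P_orb c (k + 1)))
      \<longleftrightarrow> (\<exists>t. of_int k \<le> t \<and> t \<le> of_int k + 1 \<and> half_sign s *\<^sub>R p = boundary_path c t \<and>
            half_sign s' *\<^sub>R p' = boundary_path c (2 * of_int k + 1 - t))" for k
    unfolding edge_eq_boundary_path image_iff Bex_def atLeastAtMost_iff using partner by blast
  then show ?thesis
    unfolding symclp_glue_iff_edge using False by blast
qed (simp add: symclp_glue_iff_edge)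

lemma mem_cls_iff: "y \<in> cls c x \<longleftrightarrow> equivclp (glue c) x y"
  by (simp add: cls_def)

lemma cls_eq_iff: "cls c x = cls c y \<longleftrightarrow> equivclp (glue c) x y"
  unfolding cls_def by (auto intro: equivclp_trans equivclp_sym)

section \<open>The homeomorphisms between the surfaces\<close>

definition transfer :: "real \<Rightarrow> real \<Rightarrow> plane \<Rightarrow> plane" where
  "transfer c c' p = strip_to_hull c' (hull_to_strip c p)"

definition transfer_piece :: "real \<Rightarrow> real \<Rightarrow> half \<times> plane \<Rightarrow> half \<times> plane" where
  "transfer_piece c c' = (\<lambda>(s, p). (s, half_sign s *\<^sub>R transfer c c' (half_sign s *\<^sub>R p)))"

lemma transfer_boundary_path [simp]:
  "1 \<le> c \<Longrightarrow> transfer c c' (boundary_path c t) = boundary_path c' t"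
  using hull_to_strip_to_hull[of c "(t, 0)"]
  by (simp add: transfer_def strip_to_hull_def flip: zero_prod_def)

lemma transfer_P_orb [simp]: "1 \<le> c \<Longrightarrow> transfer c c' (P_orb c k) = P_orb c' k"
  using transfer_boundary_path[of c c' "of_int k"] by simp

lemma transfer_piece_same [simp]: "1 \<le> c \<Longrightarrow> transfer_piece c c x = x"
  by (cases x) (simp add: transfer_piece_def transfer_def)

lemma transfer_piece_transfer_piece [simp]:
  "1 \<le> c' \<Longrightarrow> transfer_piece c' c'' (transfer_piece c c' x) = transfer_piece c c'' x"
  by (cases x) (simp add: transfer_piece_def transfer_def)

lemma transfer_piece_polygon:
  "\<lbrakk>1 \<le> c; 1 \<le> c'; p \<in> polygon c s\<rbrakk> \<Longrightarrow> snd (transfer_piece c c' (s, p)) \<in> polygon c' s"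
  by (simp add: transfer_piece_def transfer_def mem_polygon_iff_strip)

lemma transfer_piece_image_polygon:
  assumes "1 \<le> c" "1 \<le> c'"
  shows "transfer_piece c c' ` ({s} \<times> polygon c s) = {s} \<times> polygon c' s"
proof -
  have sub: "transfer_piece c c' ` ({s} \<times> polygon c s) \<subseteq> {s} \<times> polygon c' s" if "1 \<le> c" "1 \<le> c'" for c c'
    using transfer_piece_polygon[OF that] by (force simp: transfer_piece_def)
  have "x \<in> transfer_piece c c' ` ({s} \<times> polygon c s)" if "x \<in> {s} \<times> polygon c' s" for x
    using sub[OF assms(2,1)] that assms by (intro image_eqI[of _ _ "transfer_piece c' c x"]) auto
  with sub[OF assms] show ?thesis by blast
qed

lemma symclp_glue_transfer_piece:
  assumes "1 \<le> c" "symclp (glue c) x y"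
  shows "symclp (glue c') (transfer_piece c c' x) (transfer_piece c c' y)"
proof -
  obtain s p where x: "x = (s, p)" by (cases x) blast
  obtain s' p' where y: "y = (s', p')" by (cases y) blast
  obtain k t where "s \<noteq> s'" "of_int k \<le> t" "t \<le> of_int k + 1" "half_sign s *\<^sub>R p = boundary_path c t"
    "half_sign s' *\<^sub>R p' = boundary_path c (2 * of_int k + 1 - t)"
    using assms(2) unfolding x y symclp_glue_iff_boundary_path by blast
  then show ?thesis
    using assms(1) unfolding x y transfer_piece_def case_prod_conv symclp_glue_iff_boundary_path by auto
qed

lemma equivclp_glue_transfer_piece:
  assumes "1 \<le> c" "equivclp (glue c) x y"
  shows "equivclp (glue c') (transfer_piece c c' x) (transfer_piece c c' y)"
  using assms(2)
proof induction
  case (step y z)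
  then have "symclp (glue c') (transfer_piece c c' y) (transfer_piece c c' z)"
    by (intro symclp_glue_transfer_piece[OF assms(1)]) (simp add: symclp_def)
  with step show ?case
    by (auto simp: symclp_def intro: equivclp_into_equivclp)
qed simp

text \<open>
  The map of the surfaces can hence be taken to be the image map on classes, with no
  choice of representatives.
\<close>

lemma transfer_piece_image_cls:
  assumes "1 \<le> c" "1 \<le> c'"
  shows "transfer_piece c c' ` cls c x = cls c' (transfer_piece c c' x)"
proof (intro subset_antisym subsetI)
  fix y assume "y \<in> transfer_piece c c' ` cls c x"
  then show "y \<in> cls c' (transfer_piece c c' x)"
    by (elim imageE) (simp add: mem_cls_iff equivclp_glue_transfer_piece[OF assms(1)])
next
  fix y assume "y \<in> cls c' (transfer_piece c c' x)"
  then have "transfer_piece c' c y \<in> cls c x"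
    using equivclp_glue_transfer_piece[OF assms(2), of "transfer_piece c c' x" y c] assms
    by (simp add: mem_cls_iff)
  then show "y \<in> transfer_piece c c' ` cls c x"
    using assms by (intro image_eqI[of _ _ "transfer_piece c' c y"]) auto
qed

lemma continuous_on_transfer [continuous_intros]:
  assumes "continuous_on A f" "continuous_on A f'" "continuous_on A g" "\<And>z. z \<in> A \<Longrightarrow> 1 \<le> f z"
  shows "continuous_on A (\<lambda>z. transfer (f z) (f' z) (g z))"
  unfolding transfer_def using assms by (intro continuous_intros)

lemma continuous_map_transfer_piece:
  assumes "1 \<le> c" "1 \<le> c'"
  shows "continuous_map (pieces c) (pieces c') (transfer_piece c c')"
  unfolding continuous_map_def
proof (intro conjI allI impI)
  show "transfer_piece c c' \<in> topspace (pieces c) \<rightarrow> topspace (pieces c')"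
    using transfer_piece_polygon[OF assms] by (auto simp: topspace_pieces transfer_piece_def)
next
  fix U assume U: "openin (pieces c') U"
  have "openin (top_of_set (polygon c s)) {p \<in> polygon c s. transfer_piece c c' (s, p) \<in> U}" for s
  proof -
    let ?f = "\<lambda>p. half_sign s *\<^sub>R transfer c c' (half_sign s *\<^sub>R p)"
    have "continuous_map (top_of_set (polygon c s)) (top_of_set (polygon c' s)) ?f"
      using transfer_piece_polygon[OF assms] assms
      by (auto intro!: continuous_intros simp: transfer_piece_def)
    moreover have "openin (top_of_set (polygon c' s)) {p. (s, p) \<in> U}"
      using U by (simp add: pieces_def openin_sum_topology)
    ultimately have "openin (top_of_set (polygon c s))
        {p \<in> topspace (top_of_set (polygon c s)). ?f p \<in> {p. (s, p) \<in> U}}"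
      by (rule openin_continuous_map_preimage)
    then show ?thesis by (simp add: transfer_piece_def)
  qed
  then show "openin (pieces c) {x \<in> topspace (pieces c). transfer_piece c c' x \<in> U}"
    by (auto simp: pieces_def openin_sum_topology)
qed

lemma continuous_map_image_transfer_piece:
  assumes "1 \<le> c" "1 \<le> c'"
  shows "continuous_map (surface c) (surface c') ((`) (transfer_piece c c'))"
  unfolding surface_def
proof (rule continuous_compose_quotient_map[OF quotient_map_quotient_topology])
  have "continuous_map (pieces c) (quotient_topology (pieces c') (cls c')) (cls c' \<circ> transfer_piece c c')"
    using continuous_map_transfer_piece[OF assms] quotient_map_quotient_topology
    by (intro continuous_map_compose[OF _ quotient_imp_continuous_map])
  then show "continuous_map (pieces c) (quotient_topology (pieces c') (cls c')) ((`) (transfer_piece c c') \<circ> cls c)"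
    by (rule continuous_map_eq) (simp add: transfer_piece_image_cls[OF assms])
qed

lemma homeomorphic_map_image_transfer_piece:
  assumes "1 \<le> c" "1 \<le> c'"
  shows "homeomorphic_map (surface c) (surface c') ((`) (transfer_piece c c'))"
proof -
  have "homeomorphic_maps (surface c) (surface c') ((`) (transfer_piece c c')) ((`) (transfer_piece c' c))"
    using assms by (simp add: homeomorphic_maps_def continuous_map_image_transfer_piece image_image)
  then show ?thesis
    using homeomorphic_maps_map by blast
qed

lemma transfer_piece_image_Sigma_sing:
  assumes "1 \<le> c" "1 \<le> c'"
  shows "(`) (transfer_piece c c') ` Sigma_sing c = Sigma_sing c'"
proof -
  have "transfer_piece c c' (Plus, P_orb c k) = (Plus, P_orb c' k)"
    "transfer_piece c c' (Minus, - P_orb c k) = (Minus, - P_orb c' k)" for k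
    using assms by (simp_all add: transfer_piece_def)
  then show ?thesis
    by (simp add: Sigma_sing_def image_Un image_image transfer_piece_image_cls[OF assms])
qed

lemma transfer_piece_image_Q_img:
  assumes "1 \<le> c" "1 \<le> c'"
  shows "(`) (transfer_piece c c') ` Q_img c s = Q_img c' s"
proof -
  have "(`) (transfer_piece c c') ` Q_img c s = cls c' ` transfer_piece c c' ` ({s} \<times> polygon c s)"
    by (simp only: Q_img_def image_image transfer_piece_image_cls[OF assms])
  then show ?thesis
    unfolding transfer_piece_image_polygon[OF assms] Q_img_def .
qed

section \<open>Gluing classes of nonsingular points\<close>

lemma nonsingular_strip:
  assumes "1 \<le> c" "cls c (s, p) \<notin> Sigma_sing c" "hull_to_strip c (half_sign s *\<^sub>R p) = (t, u)"
  shows "u \<noteq> 0 \<or> t \<notin> \<int>"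
proof (rule ccontr)
  assume "\<not> ?thesis"
  then obtain k where "t = of_int k" "u = 0" by (auto elim: Ints_cases)
  then have "half_sign s *\<^sub>R p = P_orb c k"
    using assms strip_to_hull_to_strip[OF assms(1), of "half_sign s *\<^sub>R p"]
    by (simp add: strip_to_hull_def flip: zero_prod_def)
  then have "p = half_sign s *\<^sub>R P_orb c k"
    by (metis half_sign_scaleR_cancel)
  then show False
    using assms(2) by (cases s) (auto simp: Sigma_sing_def)
qed

text \<open>
  A boundary point that is not a vertex lies on only one edge, and so does its partner. A second
  step of the gluing can therefore only undo the first.
\<close>

lemma equivclp_glue_nonvertex:
  assumes "1 \<le> c" "hull_to_strip c (half_sign s *\<^sub>R p) = (t, u)" "u \<noteq> 0 \<or> t \<notin> \<int>"
    and "equivclp (glue c) (s, p) y"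
  shows "y = (s, p) \<or> symclp (glue c) (s, p) y"
  using assms(4)
proof induction
  case (step y z)
  have path: "hull_to_strip c (boundary_path c t') = (t', 0)" for t'
    using hull_to_strip_to_hull[OF assms(1), of "(t', 0)"]
    by (simp add: strip_to_hull_def flip: zero_prod_def)
  have yz: "symclp (glue c) y z"
    using step.hyps(2) by (simp add: symclp_def)
  show ?case
  proof (cases "y = (s, p)")
    case False
    then have "symclp (glue c) (s, p) y" using step.IH by blast
    moreover obtain s' p' where y: "y = (s', p')" by (cases y) blast
    moreover obtain s'' p'' where z: "z = (s'', p'')" by (cases z) blast
    ultimately obtain k t' where k: "s \<noteq> s'" "of_int k \<le> t'" "t' \<le> of_int k + 1"
      "half_sign s *\<^sub>R p = boundary_path c t'"
      "half_sign s' *\<^sub>R p' = boundary_path c (2 * of_int k + 1 - t')"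
      unfolding y symclp_glue_iff_boundary_path by blast
    from yz obtain j t'' where j: "s' \<noteq> s''" "of_int j \<le> t''" "t'' \<le> of_int j + 1"
      "half_sign s' *\<^sub>R p' = boundary_path c t''"
      "half_sign s'' *\<^sub>R p'' = boundary_path c (2 * of_int j + 1 - t'')"
      unfolding y z symclp_glue_iff_boundary_path by blast
    have t: "t' = t" "t \<notin> \<int>"
      using assms(2,3) path[of t'] k(4) by auto
    have t'': "t'' = 2 * of_int k + 1 - t"
      using path[of t''] path[of "2 * of_int k + 1 - t'"] j(4) k(5) t by simp
    have "t \<noteq> of_int k" "t \<noteq> of_int (k + 1)"
      using t(2) Ints_of_int by metis+
    then have "real_of_int k < t" "t < real_of_int k + 1"
      using k(2,3) t(1) by simp_all
    then have "real_of_int j < real_of_int k + 1" "real_of_int k < real_of_int j + 1"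
      using j(2,3) t'' by linarith+
    then have "j = k" by linarith
    moreover have "s'' = s"
      using k(1) j(1) by (cases s; cases s'; cases s'') simp_all
    ultimately have "half_sign s *\<^sub>R p'' = half_sign s *\<^sub>R p"
      using j(5) k(4) t t'' by simp
    then have "p'' = p" by (metis half_sign_scaleR_cancel)
    then show ?thesis using \<open>s'' = s\<close> z by simp
  qed (use yz in simp)
qed simp

lemma nonsingular_same_class:
  assumes "1 \<le> c" "cls c (s, p) \<notin> Sigma_sing c" "cls c (s, p) = cls c (s', p')"
  shows "(s', p') = (s, p) \<or>
    s \<noteq> s' \<and> (\<exists>k. half_sign s *\<^sub>R p \<in> edge c k \<and> p' = p - half_sign s *\<^sub>R (P_orb c k + P_orb c (k + 1)))"
proof -
  obtain t u where "hull_to_strip c (half_sign s *\<^sub>R p) = (t, u)" by fastforce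
  with assms show ?thesis
    using equivclp_glue_nonvertex[OF assms(1)] nonsingular_strip[OF assms(1,2)]
    by (metis cls_eq_iff symclp_glue_iff_edge)
qed

section \<open>Sheets and chains of the bundle\<close>

lemma mem_sheet_iff: "(c, p) \<in> sheet s \<longleftrightarrow> 1 \<le> c \<and> p \<in> polygon c s \<and> cls c (s, p) \<notin> Sigma_sing c"
  by (simp add: sheet_def)

lemma B_proj_sheet: "u \<in> sheet s \<Longrightarrow> B_proj s u \<in> B_bundle"
  by (cases u) (auto simp: B_proj_def B_bundle_def mem_sheet_iff S_pts_def topspace_pieces)

lemma B_bundle_cases:
  assumes "b \<in> B_bundle"
  obtains s u where "u \<in> sheet s" "b = B_proj s u"
proof -
  from assms obtain c x where b: "b = (c, x)" "1 \<le> c" "x \<in> S_pts c" "x \<notin> Sigma_sing c"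
    by (auto simp: B_bundle_def)
  then obtain s p where "p \<in> polygon c s" "x = cls c (s, p)"
    by (auto simp: S_pts_def topspace_pieces)
  with b show ?thesis
    by (intro that[of "(c, p)" s]) (auto simp: mem_sheet_iff B_proj_def)
qed

text \<open>
  The polygon of the other kind, translated by this vector, is glued to the polygon of kind \<open>s\<close>
  along the \<open>k\<close>-th edge of the latter.
\<close>

definition neighbour_shift :: "half \<Rightarrow> int \<Rightarrow> real \<Rightarrow> plane" where
  "neighbour_shift s k c = half_sign s *\<^sub>R (P_orb c k + P_orb c (k + 1))"

lemma B_proj_eq_cases:
  assumes "(c, p) \<in> sheet s" "B_proj s (c, p) = B_proj s' (c', p')"
  shows "c' = c" "s' = s \<and> p' = p \<or>
    s' \<noteq> s \<and> (\<exists>k. half_sign s *\<^sub>R p \<in> edge c k \<and> p' = p - neighbour_shift s k c)"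
  using assms nonsingular_same_class[of c s p s' p']
  by (auto simp: B_proj_def mem_sheet_iff neighbour_shift_def)

lemma B_proj_inj_on_sheet:
  assumes "u \<in> sheet s" "B_proj s u = B_proj s v"
  shows "u = v"
proof -
  obtain c p where u: "u = (c, p)" by (cases u) blast
  obtain c' p' where v: "v = (c', p')" by (cases v) blast
  show ?thesis
    using B_proj_eq_cases[of c p s s c' p'] assms unfolding u v by simp
qed

lemma sheet_neighbour:
  assumes "(c, p) \<in> sheet s" "half_sign s *\<^sub>R p \<in> edge c k" "s \<noteq> s'"
  shows "(c, p - neighbour_shift s k c) \<in> sheet s'"
    and "B_proj s' (c, p - neighbour_shift s k c) = B_proj s (c, p)"
proof -
  let ?q = "p - neighbour_shift s k c"
  have glued: "symclp (glue c) (s, p) (s', ?q)"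
    using assms by (auto simp: symclp_glue_iff_edge neighbour_shift_def)
  then have "cls c (s, p) = cls c (s', ?q)"
    unfolding cls_eq_iff by (auto simp: symclp_def)
  moreover have "symclp (glue c) (s', ?q) (s, p)"
    using glued by (auto simp: symclp_def)
  then have "?q \<in> polygon c s'"
    unfolding symclp_glue_iff_edge mem_polygon_iff using edge_subset_Q_plus by blast
  ultimately show "(c, ?q) \<in> sheet s'" "B_proj s' (c, ?q) = B_proj s (c, p)"
    using assms(1) by (simp_all add: mem_sheet_iff B_proj_def)
qed

lemma B_chain_in_bundle: "B_chain a b l \<Longrightarrow> a \<in> B_bundle \<and> b \<in> B_bundle \<and> 0 \<le> l"
  by (induction rule: B_chain.induct) (auto simp: B_proj_sheet)

lemma B_chain_trans:
  assumes "B_chain b d m" "B_chain a b l"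
  shows "B_chain a d (l + m)"
  using assms
proof (induction rule: B_chain.induct)
  case (step b s u m v)
  then show ?case using B_chain.step[of a s u "l + m" v] by (simp add: add.assoc)
qed simp

lemma B_chain_one: "\<lbrakk>u \<in> sheet s; v \<in> sheet s\<rbrakk> \<Longrightarrow> B_chain (B_proj s u) (B_proj s v) (dist u v)"
  using B_chain.step[OF B_chain.refl, of s u v] by (simp add: B_proj_sheet)

lemma B_chain_sym: "B_chain a b l \<Longrightarrow> B_chain b a l"
proof (induction rule: B_chain.induct)
  case (step b s u l v)
  then show ?case
    using B_chain_trans[OF step.IH B_chain_one[of v s u]] by (simp add: add.commute dist_commute)
qed (rule B_chain.refl)

text \<open>
  The two sheets meet, for instance at the midpoint of an edge. Without this the infimum defining the distance could
  range over the empty set. The class of the midpoint consists of the midpoint and its partner, and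
  neither is a vertex.
\<close>

lemma exists_crossing_point: "\<exists>u v. u \<in> sheet Plus \<and> v \<in> sheet Minus \<and> B_proj Plus u = B_proj Minus v"
proof -
  let ?m = "boundary_path 1 (1/2)"
  have m: "?m \<in> edge 1 0"
    using boundary_path_in_edge[of 1 "1/2"] by simp
  have strip: "hull_to_strip 1 (boundary_path 1 t) = (t, 0)" for t
    using hull_to_strip_to_hull[of 1 "(t, 0)"] by (simp add: strip_to_hull_def flip: zero_prod_def)
  have half: "(1/2 :: real) \<noteq> of_int k" for k
  proof
    assume "(1/2 :: real) = of_int k"
    then have "of_int (2 * k) = (of_int 1 :: real)" by simp
    then have "2 * k = 1" by (simp only: of_int_eq_iff)
    then show False by presburger
  qed
  then have "(1/2 :: real) \<notin> \<int>" by (auto elim!: Ints_cases)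
  then have cls: "y = (Plus, ?m) \<or> symclp (glue 1) (Plus, ?m) y" if "equivclp (glue 1) (Plus, ?m) y" for y
    using equivclp_glue_nonvertex[of 1 Plus ?m "1/2" 0 y] that by (simp add: strip)
  have "cls 1 (Plus, ?m) \<noteq> cls 1 (Plus, P_orb 1 k)" for k
  proof
    assume "cls 1 (Plus, ?m) = cls 1 (Plus, P_orb 1 k)"
    then have "boundary_path 1 (1/2) = boundary_path 1 (of_int k)"
      using cls[of "(Plus, P_orb 1 k)"] by (simp add: cls_eq_iff symclp_glue_iff_edge)
    then show False
      using strip[of "1/2"] strip[of "of_int k"] half[of k] by simp
  qed
  moreover have "cls 1 (Plus, ?m) \<noteq> cls 1 (Minus, - P_orb 1 k)" for k
  proof
    assume "cls 1 (Plus, ?m) = cls 1 (Minus, - P_orb 1 k)"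
    then have "symclp (glue 1) (Plus, ?m) (Minus, - P_orb 1 k)"
      using cls[of "(Minus, - P_orb 1 k)"] by (simp add: cls_eq_iff)
    then obtain j t where t: "boundary_path 1 (1/2) = boundary_path 1 t"
      "boundary_path 1 (of_int k) = boundary_path 1 (2 * of_int j + 1 - t)"
      by (auto simp: symclp_glue_iff_boundary_path)
    have "t = 1/2"
      using strip[of "1/2"] strip[of t] t(1) by simp
    moreover have "of_int k = 2 * of_int j + 1 - t"
      using arg_cong[OF t(2), of "hull_to_strip 1"] by (simp only: strip prod.inject)
    ultimately have "1/2 = real_of_int (k - 2 * j)"
      by (simp only: of_int_diff of_int_mult of_int_numeral)
    then show False
      using half by blast
  qed
  ultimately have "cls 1 (Plus, ?m) \<notin> Sigma_sing 1"
    by (auto simp: Sigma_sing_def)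
  then have sheet: "(1, ?m) \<in> sheet Plus"
    using m edge_subset_Q_plus by (auto simp: mem_sheet_iff)
  have "(1, ?m - neighbour_shift Plus 0 1) \<in> sheet Minus"
    "B_proj Minus (1, ?m - neighbour_shift Plus 0 1) = B_proj Plus (1, ?m)"
    using sheet_neighbour[OF sheet, of 0 Minus] m by simp_all
  with sheet show ?thesis by metis
qed

lemma B_chain_exists:
  assumes "a \<in> B_bundle" "b \<in> B_bundle"
  shows "\<exists>l. B_chain a b l"
proof -
  obtain u v where uv: "u \<in> sheet Plus" "v \<in> sheet Minus" "B_proj Plus u = B_proj Minus v"
    using exists_crossing_point by blast
  have "\<exists>l. B_chain (B_proj Plus u) d l" if d: "d \<in> B_bundle" for d
  proof -
    obtain s w where w: "w \<in> sheet s" "d = B_proj s w"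
      using B_bundle_cases[OF d] by blast
    show ?thesis
      using B_chain_one[of u s w] B_chain_one[of v s w] uv w by (cases s) auto
  qed
  then obtain l m where "B_chain (B_proj Plus u) a l" "B_chain (B_proj Plus u) b m"
    using assms by blast
  then show ?thesis
    using B_chain_trans B_chain_sym by blast
qed

lemma bundle_dist_le_chain:
  assumes "B_chain a b l"
  shows "bundle_dist a b \<le> l"
proof -
  have "bdd_below {l. B_chain a b l}"
    using B_chain_in_bundle by (intro bdd_belowI[of _ 0]) blast
  with assms have "Inf {l. B_chain a b l} \<le> l"
    by (intro cInf_lower) simp_all
  with B_chain_in_bundle[OF assms] show ?thesis
    by (simp add: bundle_dist_def)
qed

lemma bundle_dist_le_dist:
  "\<lbrakk>u \<in> sheet s; v \<in> sheet s\<rbrakk> \<Longrightarrow> bundle_dist (B_proj s u) (B_proj s v) \<le> dist u v"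
  by (intro bundle_dist_le_chain B_chain_one)

lemma bundle_dist_lessD:
  assumes "a \<in> B_bundle" "b \<in> B_bundle" "bundle_dist a b < d"
  obtains l where "B_chain a b l" "l < d"
proof -
  have "{l. B_chain a b l} \<noteq> {}" using B_chain_exists[OF assms(1,2)] by simp
  then show ?thesis
    using cInf_lessD[of "{l. B_chain a b l}" d] assms that by (auto simp: bundle_dist_def)
qed

lemma bundle_dist_nonneg: "0 \<le> bundle_dist a b"
proof (cases "a \<in> B_bundle \<and> b \<in> B_bundle")
  case True
  then have "{l. B_chain a b l} \<noteq> {}" using B_chain_exists by simp
  then have "0 \<le> Inf {l. B_chain a b l}"
    using B_chain_in_bundle by (intro cInf_greatest) auto
  with True show ?thesis by (simp add: bundle_dist_def)
qed (auto simp: bundle_dist_def)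

lemma bundle_dist_commute: "bundle_dist a b = bundle_dist b a"
proof -
  have "{l. B_chain a b l} = {l. B_chain b a l}" using B_chain_sym by blast
  then show ?thesis by (auto simp: bundle_dist_def)
qed

lemma bundle_dist_triangle:
  assumes "a \<in> B_bundle" "b \<in> B_bundle" "d \<in> B_bundle"
  shows "bundle_dist a d \<le> bundle_dist a b + bundle_dist b d"
proof (rule field_le_epsilon)
  fix e :: real assume "0 < e"
  obtain l where l: "B_chain a b l" "l < bundle_dist a b + e / 2"
    using bundle_dist_lessD[OF assms(1,2), of "bundle_dist a b + e / 2"] \<open>0 < e\<close> by auto
  obtain m where m: "B_chain b d m" "m < bundle_dist b d + e / 2"
    using bundle_dist_lessD[OF assms(2,3), of "bundle_dist b d + e / 2"] \<open>0 < e\<close> by auto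
  have "bundle_dist a d \<le> l + m"
    using B_chain_trans[OF m(1) l(1)] by (rule bundle_dist_le_chain)
  then show "bundle_dist a d \<le> bundle_dist a b + bundle_dist b d + e"
    using l m by simp
qed

lemma continuous_on_neighbour_shift [continuous_intros]:
  "continuous_on A f \<Longrightarrow> continuous_on A (\<lambda>z. neighbour_shift s k (f z))"
  unfolding neighbour_shift_def by (intro continuous_intros)

section \<open>Short chains do not leave a neighbourhood\<close>

text \<open>
  Near a nonsingular point of a sheet there is at most one edge, the \<open>k\<close>-th, and it comes near only if the
  point itself lies on it. The second half says the same on the far side of that edge, in terms of
  the unfolded position of a point of the other sheet. Both halves hold by continuity of the
  coordinates, as the time of the point, or of its partner, is strictly between \<open>k\<close> and \<open>k + 1\<close>.
\<close>

lemma edge_index_locally_constant: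
  assumes "(c0, p0) \<in> sheet s"
  shows "\<exists>k r. 0 < r \<and>
    (\<forall>c p j. 1 \<le> c \<and> dist (c, p) (c0, p0) < r \<and> half_sign s *\<^sub>R p \<in> edge c j \<longrightarrow>
      j = k \<and> half_sign s *\<^sub>R p0 \<in> edge c0 k) \<and>
    (half_sign s *\<^sub>R p0 \<in> edge c0 k \<longrightarrow>
      (\<forall>c q j. 1 \<le> c \<and> dist (c, q + neighbour_shift s k c) (c0, p0) < r \<and>
        - (half_sign s *\<^sub>R q) \<in> edge c j \<longrightarrow> j = k))"
proof -
  have c0: "1 \<le> c0" using assms by (simp add: mem_sheet_iff)
  let ?S = "{1..} \<times> (UNIV :: plane set)"
  let ?F = "\<lambda>z. hull_to_strip (fst z) (half_sign s *\<^sub>R snd z)"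
  obtain t0 u0 where tu: "hull_to_strip c0 (half_sign s *\<^sub>R p0) = (t0, u0)" by fastforce
  have nonvertex: "u0 \<noteq> 0 \<or> t0 \<notin> \<int>"
    using nonsingular_strip[OF c0 _ tu] assms by (simp add: mem_sheet_iff)
  have F0: "?F (c0, p0) = (t0, u0)" by (simp add: tu)
  have "continuous_on ?S ?F"
    by (intro continuous_intros) auto
  then have near: "\<exists>r>0. \<forall>z\<in>?S. dist z (c0, p0) < r \<longrightarrow> dist (?F z) (t0, u0) < e" if "0 < e" for e
    using that c0 unfolding continuous_on_iff F0[symmetric] by (metis SigmaI UNIV_I atLeast_iff)
  show ?thesis
  proof (cases "u0 = 0")
    case False
    then obtain r where r: "0 < r" "\<And>z. \<lbrakk>z \<in> ?S; dist z (c0, p0) < r\<rbrakk> \<Longrightarrow> dist (?F z) (t0, u0) < \<bar>u0\<bar>"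
      using near[of "\<bar>u0\<bar>"] by auto
    have "half_sign s *\<^sub>R p \<notin> edge c j" if "1 \<le> c" "dist (c, p) (c0, p0) < r" for c p j
    proof
      assume "half_sign s *\<^sub>R p \<in> edge c j"
      then have "snd (?F (c, p)) = 0"
        using that by (auto simp: mem_edge_iff_strip)
      moreover have "dist (?F (c, p)) (t0, u0) < \<bar>u0\<bar>"
        using r(2)[of "(c, p)"] that by simp
      ultimately show False
        using dist_snd_le[of "?F (c, p)" "(t0, u0)"] by (simp add: dist_real_def)
    qed
    moreover have "half_sign s *\<^sub>R p0 \<notin> edge c0 0"
      using False by (simp add: mem_edge_iff_strip[OF c0] tu)
    ultimately show ?thesis
      using r(1) by blast
  next
    case True
    define k where "k = \<lfloor>t0\<rfloor>"
    have "t0 \<noteq> of_int k" using nonvertex True by auto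
    then have k: "of_int k < t0" "t0 < of_int k + 1"
      using floor_correct[of t0] unfolding k_def by linarith+
    define e where "e = min (t0 - of_int k) (of_int k + 1 - t0)"
    have e: "0 < e" "e \<le> t0 - of_int k" "e \<le> of_int k + 1 - t0"
      using k by (auto simp: e_def)
    have pinned: "j = k"
      if "hull_to_strip c p \<in> {of_int j..of_int j + 1} \<times> {0}" "dist (hull_to_strip c p) (t, 0) < e"
        "of_int k + e \<le> t" "t \<le> of_int k + 1 - e" for c p j t
    proof -
      have "\<bar>fst (hull_to_strip c p) - t\<bar> < e"
        using dist_fst_le[of "hull_to_strip c p" "(t, 0)"] that(2) by (simp add: dist_real_def)
      then have "real_of_int j < of_int k + 1" "real_of_int k < of_int j + 1"
        using that(1,3,4) by auto
      then show ?thesis by linarith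
    qed
    obtain r1 where r1: "0 < r1" "\<And>z. \<lbrakk>z \<in> ?S; dist z (c0, p0) < r1\<rbrakk> \<Longrightarrow> dist (?F z) (t0, u0) < e"
      using near[OF e(1)] by auto
    \<comment> \<open>the coordinates, on the other sheet, of a point given by its unfolded position\<close>
    let ?G = "\<lambda>z. hull_to_strip (fst z) (- (half_sign s *\<^sub>R (snd z - neighbour_shift s k (fst z))))"
    have p0: "half_sign s *\<^sub>R p0 = boundary_path c0 t0"
      using strip_to_hull_to_strip[OF c0, of "half_sign s *\<^sub>R p0"] True
      by (simp add: tu strip_to_hull_def flip: zero_prod_def)
    have "?G (c0, p0) = hull_to_strip c0 (boundary_path c0 (2 * of_int k + 1 - t0))"
      using k by (simp add: boundary_path_reflect neighbour_shift_def scaleR_diff_right p0)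
    also have "\<dots> = (2 * of_int k + 1 - t0, 0)"
      using hull_to_strip_to_hull[OF c0, of "(2 * of_int k + 1 - t0, 0)"]
      by (simp add: strip_to_hull_def flip: zero_prod_def)
    finally have G0: "?G (c0, p0) = (2 * of_int k + 1 - t0, 0)" .
    have "continuous_on ?S ?G"
      by (intro continuous_intros) auto
    then obtain r2 where r2: "0 < r2" "\<And>z. \<lbrakk>z \<in> ?S; dist z (c0, p0) < r2\<rbrakk> \<Longrightarrow>
        dist (?G z) (2 * of_int k + 1 - t0, 0) < e"
      using e(1) c0 unfolding continuous_on_iff G0[symmetric]
      by (metis SigmaI UNIV_I atLeast_iff)
    have "j = k" if "1 \<le> c" "dist (c, p) (c0, p0) < min r1 r2" "half_sign s *\<^sub>R p \<in> edge c j" for c p j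
      using r1(2)[of "(c, p)"] that True e
      by (intro pinned[of c "half_sign s *\<^sub>R p" j t0]) (auto simp: mem_edge_iff_strip)
    moreover have "half_sign s *\<^sub>R p0 \<in> edge c0 k"
      using k True by (simp add: mem_edge_iff_strip[OF c0] tu)
    moreover have "j = k" if "1 \<le> c" "dist (c, q + neighbour_shift s k c) (c0, p0) < min r1 r2"
      "- (half_sign s *\<^sub>R q) \<in> edge c j" for c q j
      using r2(2)[of "(c, q + neighbour_shift s k c)"] that e
      by (intro pinned[of c "- (half_sign s *\<^sub>R q)" j "2 * of_int k + 1 - t0"]) (auto simp: mem_edge_iff_strip)
    ultimately show ?thesis
      using r1(1) r2(1) by (intro exI[of _ k] exI[of _ "min r1 r2"]) auto
  qed
qed

lemma shear_lipschitz:
  fixes w :: "real \<Rightarrow> plane"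
  assumes "K-lipschitz_on A w" "c \<in> A" "c' \<in> A"
  shows "dist (c, q + w c) (c', q' + w c') \<le> (1 + K) * dist (c, q) (c', q')"
proof -
  have K: "0 \<le> K" using assms(1) by (rule lipschitz_on_nonneg)
  have "dist (c, q + w c) (c', q' + w c') = norm (((c, q) - (c', q')) + (0, w c - w c'))"
    by (simp add: dist_norm algebra_simps)
  also have "\<dots> \<le> dist (c, q) (c', q') + norm (0 :: real, w c - w c')"
    unfolding dist_norm by (rule norm_triangle_ineq)
  also have "norm (0 :: real, w c - w c') = dist (w c) (w c')"
    by (simp add: norm_Pair dist_norm)
  also have "\<dots> \<le> K * dist c c'"
    by (rule lipschitz_onD[OF assms])
  also have "\<dots> \<le> K * dist (c, q) (c', q')"
    using dist_fst_le[of "(c, q)" "(c', q')"] K by (intro mult_left_mono) auto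
  finally show ?thesis by (simp add: algebra_simps)
qed

lemma neighbour_shift_lipschitz: "\<exists>K. K-lipschitz_on {a..b} (neighbour_shift s k)"
proof -
  obtain K L where "K-lipschitz_on {a..b} (\<lambda>c. P_orb c k)" "L-lipschitz_on {a..b} (\<lambda>c. P_orb c (k + 1))"
    using P_orb_lipschitz_on_interval by meson
  then have "(\<bar>half_sign s\<bar> * (K + L))-lipschitz_on {a..b} (\<lambda>c. half_sign s *\<^sub>R (P_orb c k + P_orb c (k + 1)))"
    by (intro lipschitz_on_cmult lipschitz_on_add)
  then show ?thesis
    by (auto simp: neighbour_shift_def[abs_def])
qed

text \<open>
  Fix a representative \<open>(c0, p0)\<close> of \<open>b0\<close>. The map \<open>\<psi>\<close> unfolds the other sheet across the edge that may contain
  \<open>p0\<close>; on that edge it is compatible with the gluing. The invariant along a chain of length \<open>l\<close> is that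
  every representative of its end point unfolds into the ball of radius \<open>L l\<close> about \<open>(c0, p0)\<close>,
  where \<open>L\<close> is a Lipschitz constant for \<open>\<psi>\<close> and its inverse at parameters up to \<open>c0 + 1\<close>. A step inside a sheet adds at most \<open>L\<close> times
  its length. Passing to the other representative (\<open>cross\<close>) adds nothing, because
  within the ball only the chosen edge can be crossed.
\<close>

lemma B_chain_short_same_sheet:
  assumes "b0 \<in> B_bundle" "0 < \<eta>"
  shows "\<exists>\<delta>>0. \<forall>b l. B_chain b0 b l \<and> l < \<delta> \<longrightarrow>
    (\<exists>s u v. u \<in> sheet s \<and> v \<in> sheet s \<and> B_proj s u = b0 \<and> B_proj s v = b \<and> dist u v < \<eta>)"
proof -
  obtain s0 c0 p0 where u0: "(c0, p0) \<in> sheet s0" and b0: "b0 = B_proj s0 (c0, p0)"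
    using B_bundle_cases[OF assms(1)] by (metis surj_pair)
  have c0: "1 \<le> c0" using u0 by (simp add: mem_sheet_iff)
  obtain k r where r: "0 < r"
    and own: "\<And>c p j. \<lbrakk>1 \<le> c; dist (c, p) (c0, p0) < r; half_sign s0 *\<^sub>R p \<in> edge c j\<rbrakk>
      \<Longrightarrow> j = k \<and> half_sign s0 *\<^sub>R p0 \<in> edge c0 k"
    and other: "\<And>c q j. \<lbrakk>half_sign s0 *\<^sub>R p0 \<in> edge c0 k; 1 \<le> c;
        dist (c, q + neighbour_shift s0 k c) (c0, p0) < r; - (half_sign s0 *\<^sub>R q) \<in> edge c j\<rbrakk> \<Longrightarrow> j = k"
    using edge_index_locally_constant[OF u0] by blast
  obtain K where K: "K-lipschitz_on {1..c0 + 1} (neighbour_shift s0 k)"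
    using neighbour_shift_lipschitz by blast
  then have K': "K-lipschitz_on {1..c0 + 1} (\<lambda>c. - neighbour_shift s0 k c)"
    by (rule lipschitz_on_minus)
  define L where "L = 1 + K"
  have L: "1 \<le> L" using lipschitz_on_nonneg[OF K] by (simp add: L_def)
  define \<psi> where "\<psi> s v = (if s = s0 then v else (fst v, snd v + neighbour_shift s0 k (fst v)))"
    for s and v :: "real \<times> plane"
  have fst_\<psi> [simp]: "fst (\<psi> s v) = fst v" for s v
    by (simp add: \<psi>_def)
  have \<psi>_lipschitz: "dist (\<psi> s u) (\<psi> s v) \<le> L * dist u v" "dist u v \<le> L * dist (\<psi> s u) (\<psi> s v)"
    if "fst u \<in> {1..c0 + 1}" "fst v \<in> {1..c0 + 1}" for s u v
  proof -
    have "dist u v \<le> L * dist u v"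
      using L mult_right_mono[of 1 L "dist u v"] by simp
    then show "dist (\<psi> s u) (\<psi> s v) \<le> L * dist u v" "dist u v \<le> L * dist (\<psi> s u) (\<psi> s v)"
      using shear_lipschitz[OF K that, of "snd u" "snd v"]
        shear_lipschitz[OF K' that, of "snd (\<psi> s u)" "snd (\<psi> s v)"]
      by (auto simp: \<psi>_def L_def)
  qed
  \<comment> \<open>The unfolded chain stays in the ball of radius \<open>r\<close>, and in the range of parameters in which \<open>L\<close> is valid;
      undoing the unfolding at the end costs a second factor \<open>L\<close>.\<close>
  define \<delta> where "\<delta> = min (min r 1 / L) (\<eta> / (L * L))"
  have \<delta>: "0 < \<delta>" "L * \<delta> \<le> r" "L * \<delta> \<le> 1" "L * (L * \<delta>) \<le> \<eta>"
  proof -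
    show "0 < \<delta>" using L r assms(2) by (simp add: \<delta>_def)
    have "\<delta> \<le> min r 1 / L" "\<delta> \<le> \<eta> / (L * L)" by (simp_all add: \<delta>_def)
    then show "L * \<delta> \<le> r" "L * \<delta> \<le> 1" "L * (L * \<delta>) \<le> \<eta>"
      using L by (simp_all add: pos_le_divide_eq algebra_simps)
  qed
  define near where "near s v l \<longleftrightarrow>
      dist (\<psi> s v) (c0, p0) \<le> L * l \<and> (s \<noteq> s0 \<longrightarrow> half_sign s0 *\<^sub>R p0 \<in> edge c0 k)"
    for s v l
  have cross: "near s' v' l"
    if near: "near s v l" and l: "l < \<delta>" and v: "v \<in> sheet s" and eq: "B_proj s v = B_proj s' v'" for s v s' v' l
  proof -
    obtain c q where cq: "v = (c, q)" by (cases v) blast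
    obtain c' q' where cq': "v' = (c', q')" by (cases v') blast
    have c: "1 \<le> c" using v by (simp add: cq mem_sheet_iff)
    have "L * l < L * \<delta>" using l L by simp
    then have within: "dist (\<psi> s v) (c0, p0) < r"
      using near \<delta>(2) unfolding near_def by linarith
    have "c' = c" "s' = s \<and> q' = q \<or>
      s' \<noteq> s \<and> (\<exists>j. half_sign s *\<^sub>R q \<in> edge c j \<and> q' = q - neighbour_shift s j c)"
      using B_proj_eq_cases[of c q s s' c' q'] v eq by (simp_all add: cq cq')
    then consider "s' = s" "v' = v"
      | j where "s' \<noteq> s" "half_sign s *\<^sub>R q \<in> edge c j" "q' = q - neighbour_shift s j c" "c' = c"
      by (auto simp: cq cq')
    then show ?thesis
    proof cases
      case 1
      then show ?thesis using near by simp
    next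
      case (2 j)
      show ?thesis
      proof (cases "s = s0")
        case True
        then have "j = k \<and> half_sign s0 *\<^sub>R p0 \<in> edge c0 k"
          using own[of c q j] within c 2(2) by (simp add: \<psi>_def cq)
        then show ?thesis
          using near 2 True by (simp add: near_def \<psi>_def cq cq')
      next
        case False
        then have "s' = s0"
          using 2(1) by (cases s; cases s'; cases s0) simp_all
        have "half_sign s0 *\<^sub>R p0 \<in> edge c0 k"
          using near False by (simp add: near_def)
        moreover have "- (half_sign s0 *\<^sub>R q) \<in> edge c j"
          using 2(2) half_sign_other[of s0 s] False by simp
        ultimately have "j = k"
          using other[of c q j] within c False by (simp add: \<psi>_def cq)
        then have "q' = q + neighbour_shift s0 k c"
          using 2(3) half_sign_other[of s0 s] False by (simp add: neighbour_shift_def)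
        then show ?thesis
          using near False \<open>s' = s0\<close> 2(4) by (simp add: near_def \<psi>_def cq cq')
      qed
    qed
  qed
  have in_range: "fst v \<in> {1..c0 + 1}" if "v \<in> sheet s" "dist (\<psi> s v) (c0, p0) \<le> 1" for s v
    using dist_fst_le[of "\<psi> s v" "(c0, p0)"] that by (cases v) (auto simp: dist_real_def mem_sheet_iff)
  have chain: "\<forall>s v. v \<in> sheet s \<and> B_proj s v = b \<longrightarrow> near s v l"
    if "B_chain a b l" "a = b0" "l < \<delta>" for a b l
    using that
  proof (induction rule: B_chain.induct)
    case (refl b)
    have "near s0 (c0, p0) 0" by (simp add: near_def \<psi>_def)
    then show ?case
      using cross[of s0 "(c0, p0)" 0] \<delta>(1) u0 refl b0 by auto
  next
    case (step a s u l v)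
    then have l: "l < \<delta>" "l + dist u v < \<delta>" using zero_le_dist[of u v] by linarith+
    then have u: "near s u l" using step by blast
    have Ll: "L * (l + dist u v) \<le> 1" "dist u v \<le> L * dist u v"
    proof -
      show "L * (l + dist u v) \<le> 1"
        using mult_left_mono[of "l + dist u v" \<delta> L] l L \<delta>(3) by linarith
      show "dist u v \<le> L * dist u v"
        using L mult_right_mono[of 1 L "dist u v"] by simp
    qed
    have du: "dist (\<psi> s u) (c0, p0) \<le> L * l"
      using u by (simp add: near_def)
    then have "dist (\<psi> s u) (c0, p0) \<le> 1"
      using Ll[unfolded distrib_left] zero_le_dist[of u v] by linarith
    then have fu: "fst u \<in> {1..c0 + 1}"
      using in_range step.hyps by blast
    have "\<bar>fst u - c0\<bar> \<le> L * l"
      using dist_fst_le[of "\<psi> s u" "(c0, p0)"] du by (simp add: dist_real_def)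
    moreover have "\<bar>fst v - fst u\<bar> \<le> dist u v"
      using dist_fst_le[of v u] by (simp add: dist_real_def dist_commute)
    ultimately have "fst v \<le> c0 + 1"
      using Ll by (simp add: distrib_left)
    then have fv: "fst v \<in> {1..c0 + 1}"
      using step.hyps(3) by (cases v) (simp add: mem_sheet_iff)
    have "dist (\<psi> s v) (c0, p0) \<le> L * dist u v + L * l"
      using dist_triangle[of "\<psi> s v" "(c0, p0)" "\<psi> s u"] \<psi>_lipschitz(1)[OF fu fv, of s] du
      by (simp add: dist_commute)
    then have "near s v (l + dist u v)"
      using u by (simp add: near_def distrib_left)
    then show ?case
      using cross[OF _ l(2) step.hyps(3)] by metis
  qed
  show ?thesis
  proof (intro exI[of _ \<delta>] conjI allI impI \<delta>(1))
    fix b l assume bl: "B_chain b0 b l \<and> l < \<delta>"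
    then obtain s v where v: "v \<in> sheet s" "b = B_proj s v"
      using B_chain_in_bundle B_bundle_cases by metis
    then have near: "near s v l" using chain bl by blast
    have "L * l < L * \<delta>" using bl L by simp
    then have "L * (L * l) < \<eta>"
      using \<delta>(4) L mult_strict_left_mono[of "L * l" "L * \<delta>" L] by linarith
    have dv: "dist (\<psi> s v) (c0, p0) \<le> L * l" using near by (simp add: near_def)
    define u where "u = (if s = s0 then (c0, p0) else (c0, p0 - neighbour_shift s0 k c0))"
    have "u \<in> sheet s \<and> B_proj s u = b0"
      using sheet_neighbour[OF u0, of k s] near u0 b0 by (auto simp: near_def u_def)
    moreover have "\<psi> s u = (c0, p0)" "fst u = c0"
      by (simp_all add: \<psi>_def u_def)
    moreover have "fst v \<in> {1..c0 + 1}"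
      using in_range[OF v(1)] dv \<open>L * l < L * \<delta>\<close> \<delta>(3) by linarith
    ultimately have "dist u v \<le> L * dist (c0, p0) (\<psi> s v)"
      using \<psi>_lipschitz(2)[of u v s] c0 by simp
    also have "\<dots> \<le> L * (L * l)"
      using dv L by (simp add: dist_commute)
    finally have "dist u v < \<eta>"
      using \<open>L * (L * l) < \<eta>\<close> by simp
    then show "\<exists>s u v. u \<in> sheet s \<and> v \<in> sheet s \<and> B_proj s u = b0 \<and> B_proj s v = b \<and> dist u v < \<eta>"
      using \<open>u \<in> sheet s \<and> B_proj s u = b0\<close> v by blast
  qed
qed

lemma bundle_dist_small_same_sheet:
  assumes "b0 \<in> B_bundle" "0 < \<eta>"
  obtains \<delta> where "0 < \<delta>"
    "\<And>b. \<lbrakk>b \<in> B_bundle; bundle_dist b0 b < \<delta>\<rbrakk> \<Longrightarrow>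
      \<exists>s u v. u \<in> sheet s \<and> v \<in> sheet s \<and> B_proj s u = b0 \<and> B_proj s v = b \<and> dist u v < \<eta>"
  using B_chain_short_same_sheet[OF assms] bundle_dist_lessD[OF assms(1)] by metis

lemma half_uniform_radius:
  assumes "\<And>s :: half. \<exists>r>0. P s r" "\<And>s r r'. \<lbrakk>P s r; 0 < r'; r' \<le> r\<rbrakk> \<Longrightarrow> P s r'"
  shows "\<exists>r>0 :: real. \<forall>s. P s r"
proof -
  obtain r1 r2 where r: "0 < r1" "P Plus r1" "0 < r2" "P Minus r2"
    using assms(1) by metis
  have "P s (min r1 r2)" for s
    using assms(2)[of Plus r1 "min r1 r2"] assms(2)[of Minus r2 "min r1 r2"] r by (cases s) auto
  then show ?thesis using r by (intro exI[of _ "min r1 r2"]) auto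
qed

section \<open>The gluing metric and continuity over the bundle\<close>

text \<open>
  A point has at most one representative in each sheet, so the distances between
  representatives of two distinct points in a common sheet have a positive lower bound.
\<close>

lemma bundle_dist_eq_0:
  assumes "a \<in> B_bundle" "b \<in> B_bundle"
  shows "bundle_dist a b = 0 \<longleftrightarrow> a = b"
proof
  assume "a = b"
  then have "bundle_dist a b \<le> 0"
    using assms by (auto intro: bundle_dist_le_chain B_chain.refl)
  then show "bundle_dist a b = 0"
    using bundle_dist_nonneg[of a b] by simp
next
  assume 0: "bundle_dist a b = 0"
  show "a = b"
  proof (rule ccontr)
    assume "a \<noteq> b"
    let ?P = "\<lambda>s r. \<forall>u v. u \<in> sheet s \<and> v \<in> sheet s \<and> B_proj s u = a \<and> B_proj s v = b \<longrightarrow> r \<le> dist u v"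
    have "\<exists>r>0. \<forall>s. ?P s r"
    proof (rule half_uniform_radius)
      fix s
      show "\<exists>r>0. ?P s r"
      proof (cases "\<exists>u v. u \<in> sheet s \<and> v \<in> sheet s \<and> B_proj s u = a \<and> B_proj s v = b")
        case True
        then obtain u v where uv: "u \<in> sheet s" "v \<in> sheet s" "B_proj s u = a" "B_proj s v = b" by blast
        have "u' = u \<and> v' = v"
          if "u' \<in> sheet s" "v' \<in> sheet s" "B_proj s u' = a" "B_proj s v' = b" for u' v'
          using that uv B_proj_inj_on_sheet by metis
        then have "?P s (dist u v)" by blast
        moreover have "0 < dist u v" using uv \<open>a \<noteq> b\<close> by auto
        ultimately show ?thesis by blast
      next
        case False
        then have "?P s 1" by blast
        then show ?thesis using zero_less_one by blast
      qed
    next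
      fix s and r r' :: real
      assume P: "?P s r" and r': "r' \<le> r"
      show "?P s r'"
      proof (intro allI impI)
        fix u v assume "u \<in> sheet s \<and> v \<in> sheet s \<and> B_proj s u = a \<and> B_proj s v = b"
        then have "r \<le> dist u v" using P by blast
        then show "r' \<le> dist u v" using r' by simp
      qed
    qed
    then obtain r where r: "0 < r" "\<And>s. ?P s r" by blast
    show False
      using bundle_dist_small_same_sheet[OF assms(1) r(1)] assms(2) 0 r(2)
      by (metis not_less)
  qed
qed

lemma Metric_space_bundle: "Metric_space B_bundle bundle_dist"
  by (rule Metric_space.intro)
     (use bundle_dist_nonneg bundle_dist_commute bundle_dist_eq_0 bundle_dist_triangle in auto)

definition transfer_sheet :: "half \<Rightarrow> real \<times> plane \<Rightarrow> real \<Rightarrow> real \<times> plane" where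
  "transfer_sheet s u c' = (c', half_sign s *\<^sub>R transfer (fst u) c' (half_sign s *\<^sub>R snd u))"

lemma transfer_sheet:
  assumes "u \<in> sheet s" "1 \<le> c'"
  shows "transfer_sheet s u c' \<in> sheet s"
    and "B_proj s (transfer_sheet s u c') = (c', transfer_piece (fst u) c' ` snd (B_proj s u))"
proof -
  obtain c p where u: "u = (c, p)" by (cases u) blast
  have c: "1 \<le> c" "p \<in> polygon c s" "cls c (s, p) \<notin> Sigma_sing c"
    using assms(1) by (simp_all add: u mem_sheet_iff)
  obtain q where q: "transfer_piece c c' (s, p) = (s, q)" "transfer_sheet s u c' = (c', q)"
    by (simp add: transfer_piece_def transfer_sheet_def u)
  have cls: "cls c' (s, q) = transfer_piece c c' ` cls c (s, p)"
    by (simp add: transfer_piece_image_cls[OF c(1) assms(2)] q)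
  then show "B_proj s (transfer_sheet s u c') = (c', transfer_piece (fst u) c' ` snd (B_proj s u))"
    using q(2) by (simp add: B_proj_def u)
  have "cls c' (s, q) \<notin> Sigma_sing c'"
  proof
    assume "cls c' (s, q) \<in> Sigma_sing c'"
    then have "transfer_piece c' c ` cls c' (s, q) \<in> Sigma_sing c"
      using transfer_piece_image_Sigma_sing[OF assms(2) c(1)] by blast
    then show False
      using c assms(2) by (simp add: cls image_image)
  qed
  moreover have "q \<in> polygon c' s"
    using transfer_piece_polygon[OF c(1) assms(2) c(2)] q(1) by simp
  ultimately show "transfer_sheet s u c' \<in> sheet s"
    using assms(2) by (simp add: q(2) mem_sheet_iff)
qed

lemma transfer_sheet_near:
  assumes "u \<in> sheet s" "1 \<le> c0'" "0 < \<epsilon>"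
  shows "\<exists>r>0. \<forall>v\<in>sheet s. \<forall>c'\<ge>1. dist u v < r \<and> dist c0' c' < r \<longrightarrow>
    dist (transfer_sheet s u c0') (transfer_sheet s v c') < \<epsilon>"
proof -
  let ?S = "({1..} \<times> UNIV) \<times> {1..}"
  have sheet: "v \<in> {1..} \<times> UNIV" if "v \<in> sheet s" for v
    using that by (cases v) (simp add: mem_sheet_iff)
  have "continuous_on ?S (\<lambda>z. transfer_sheet s (fst z) (snd z))"
    unfolding transfer_sheet_def by (intro continuous_intros) auto
  moreover have "(u, c0') \<in> ?S" using sheet assms by auto
  ultimately obtain d where d: "0 < d" "\<And>z. \<lbrakk>z \<in> ?S; dist z (u, c0') < d\<rbrakk> \<Longrightarrow>
      dist (transfer_sheet s (fst z) (snd z)) (transfer_sheet s u c0') < \<epsilon>"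
    using assms(3) unfolding continuous_on_iff by (metis fst_conv snd_conv)
  have "dist (transfer_sheet s u c0') (transfer_sheet s v c') < \<epsilon>"
    if "v \<in> sheet s" "1 \<le> c'" "dist u v < d / 2" "dist c0' c' < d / 2" for v c'
  proof -
    have "dist (v, c') (u, c0') \<le> dist v u + dist c' c0'"
      using sqrt_sum_squares_le_sum[of "dist v u" "dist c' c0'"] by (simp add: dist_Pair_Pair)
    then have "dist (v, c') (u, c0') < d"
      using that by (simp add: dist_commute)
    then show ?thesis
      using d(2)[of "(v, c')"] sheet that by (auto simp: dist_commute)
  qed
  then show ?thesis using d(1) by (intro exI[of _ "d / 2"]) auto
qed

text \<open>
  In each sheet the map is continuous for the Euclidean distance, which dominates the gluing distance.
  Conversely a point at small gluing distance from \<open>b0\<close> is Euclidean close to \<open>b0\<close> in one of the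
  sheets. As \<open>b0\<close> has at most two representatives, one radius serves both.
\<close>

lemma continuous_map_bundle_transfer:
  "continuous_map (prod_topology bundle_topology (top_of_set {1..})) bundle_topology
     (\<lambda>((c, x), c'). (c', transfer_piece c c' ` x))"
proof -
  let ?f = "\<lambda>((c, x), c'). (c', transfer_piece c c' ` x)"
  interpret Metric_space B_bundle bundle_dist by (rule Metric_space_bundle)
  have f: "?f (B_proj s u, c') = B_proj s (transfer_sheet s u c')" if "u \<in> sheet s" "1 \<le> c'" for s u c'
  proof -
    have "fst (B_proj s u) = fst u" by (simp add: B_proj_def case_prod_unfold)
    then show ?thesis by (simp add: transfer_sheet(2)[OF that] case_prod_unfold)
  qed
  have "\<exists>U. openin (prod_topology mtopology (top_of_set {1..})) U \<and> (b0, c0') \<in> U \<and>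
      (\<forall>y\<in>U. ?f y \<in> mball (?f (b0, c0')) \<epsilon>)"
    if b0: "b0 \<in> B_bundle" and c0': "1 \<le> c0'" and \<epsilon>: "0 < \<epsilon>" for b0 c0' \<epsilon>
  proof -
    let ?P = "\<lambda>s r. \<forall>u\<in>sheet s. \<forall>v\<in>sheet s. \<forall>c'\<ge>1. B_proj s u = b0 \<and> dist u v < r \<and> dist c0' c' < r \<longrightarrow>
      dist (transfer_sheet s u c0') (transfer_sheet s v c') < \<epsilon>"
    have "\<exists>r>0. \<forall>s. ?P s r"
    proof (rule half_uniform_radius)
      fix s
      show "\<exists>r>0. ?P s r"
      proof (cases "\<exists>u\<in>sheet s. B_proj s u = b0")
        case True
        then obtain u where u: "u \<in> sheet s" "B_proj s u = b0" by blast
        then have "u' = u" if "u' \<in> sheet s" "B_proj s u' = b0" for u'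
          using that B_proj_inj_on_sheet by metis
        then show ?thesis
          using transfer_sheet_near[OF u(1) c0' \<epsilon>] by metis
      next
        case False
        then show ?thesis by (intro exI[of _ 1]) auto
      qed
    next
      fix s and r r' :: real
      assume "?P s r" "r' \<le> r"
      then show "?P s r'" by (meson less_le_trans)
    qed
    then obtain r where r: "0 < r" "\<And>s. ?P s r" by blast
    obtain \<delta> where \<delta>: "0 < \<delta>"
      "\<And>b. \<lbrakk>b \<in> B_bundle; bundle_dist b0 b < \<delta>\<rbrakk> \<Longrightarrow>
        \<exists>s u v. u \<in> sheet s \<and> v \<in> sheet s \<and> B_proj s u = b0 \<and> B_proj s v = b \<and> dist u v < r"
      using bundle_dist_small_same_sheet[OF b0 r(1)] by blast
    let ?U = "mball b0 \<delta> \<times> ({1..} \<inter> ball c0' r)"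
    have "?f (b, c') \<in> mball (?f (b0, c0')) \<epsilon>" if "(b, c') \<in> ?U" for b c'
    proof -
      have "b \<in> B_bundle" "bundle_dist b0 b < \<delta>" using that by auto
      from \<delta>(2)[OF this] obtain s u v where uv: "u \<in> sheet s" "v \<in> sheet s"
        "B_proj s u = b0" "B_proj s v = b" "dist u v < r"
        by blast
      have c': "1 \<le> c'" "dist c0' c' < r" using that by auto
      let ?u = "transfer_sheet s u c0'" and ?v = "transfer_sheet s v c'"
      have "?u \<in> sheet s" "?v \<in> sheet s" using uv c0' c' transfer_sheet(1) by auto
      moreover have "dist ?u ?v < \<epsilon>" using r(2) uv c' by blast
      ultimately have "B_proj s ?v \<in> mball (B_proj s ?u) \<epsilon>"
        using bundle_dist_le_dist[of ?u s ?v] by (auto simp: B_proj_sheet)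
      then show ?thesis
        using f[OF uv(1) c0'] f[OF uv(2) c'(1)] uv(3,4) by simp
    qed
    moreover have "openin (prod_topology mtopology (top_of_set {1..})) ?U"
      by (auto simp: openin_prod_Times_iff intro: openin_open_Int)
    moreover have "(b0, c0') \<in> ?U"
      using b0 c0' r(1) \<delta>(1) by simp
    ultimately show ?thesis by blast
  qed
  then show ?thesis
    unfolding bundle_topology_def continuous_map_to_metric by auto
qed

theorem proposition2:
  shows "\<exists>h :: real \<Rightarrow> real \<Rightarrow> spoint \<Rightarrow> spoint.
    (\<forall>c\<ge>1. \<forall>c'\<ge>1. homeomorphic_map (surface c) (surface c') (h c c')) \<and>
    (\<forall>c\<ge>1. \<forall>x\<in>S_pts c. h c c x = x) \<and>
    (\<forall>c\<ge>1. \<forall>c'\<ge>1. \<forall>c''\<ge>1. \<forall>x\<in>S_pts c. h c' c'' (h c c' x) = h c c'' x) \<and>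
    (\<forall>c\<ge>1. \<forall>c'\<ge>1. h c c' ` Sigma_sing c \<subseteq> Sigma_sing c') \<and>
    (\<forall>c\<ge>1. \<forall>c'\<ge>1. h c c' ` Q_img c Plus = Q_img c' Plus \<and> h c c' ` Q_img c Minus = Q_img c' Minus) \<and>
    continuous_map (prod_topology bundle_topology (top_of_set {1..})) bundle_topology
      (\<lambda>((c, x), c'). (c', h c c' x))"
proof (rule exI[of _ "\<lambda>c c'. (`) (transfer_piece c c')"], intro conjI allI impI ballI)
  show "continuous_map (prod_topology bundle_topology (top_of_set {1..})) bundle_topology
      (\<lambda>((c, x), c'). (c', transfer_piece c c' ` x))"
    by (rule continuous_map_bundle_transfer)
qed (simp_all add: homeomorphic_map_image_transfer_piece transfer_piece_image_Sigma_sing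
  transfer_piece_image_Q_img image_image)

end
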